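(* Let $U$ be a finite-dimensional real vector space and $p\in\mathcal P(U)$ a primitive element of $\mathcal H_{\mathrm{CK}}(U)$. For $n\ge1$ put $$P_n=\sum_{a_1+2a_2+\cdots+na_n=n}(-1)^{a_1+\cdots+a_n-1}\,\frac{(a_1+\cdots+a_n-1)!}{a_1!\cdots a_n!}\,(p^{\top1})^{a_1}\cdots(p^{\top n})^{a_n}$$ (powers and products with respect to the forest product). Then for all $n\ge1$ $$p^{\top n}=\sum_{a_1+2a_2+\cdots+na_n=n}\frac{P_1^{a_1}}{a_1!}\cdots\frac{P_n^{a_n}}{a_n!}.$$ Evaluating a branched rough path $\mathbf X$ (with $U=V^*$, $\mathbf X$ being $V$-valued) on this identity expresses $\langle p^{\top n},\mathbf X_{s,t}\rangle$ as a polynomial in the path increments $\langle P_k,\mathbf X_{s,t}\rangle$, namely $$\langle p^{\top n},\mathbf X_{s,t}\rangle=\sum_{a_1+2a_2+\cdots+na_n=n}\prod_{k=1}^n\frac{\langle P_k,\mathbf X_{s,t}\rangle^{a_k}}{a_k!},$$ where each $P_k$ is primitive, so that $\langle P_k,\mathbf X_{s,t}\rangle$ is additive: $\langle P_k,\mathbf X_{s,t}\rangle=\langle P_k,\mathbf X_{s,u}\rangle+\langle P_k,\mathbf X_{u,t}\rangle$.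
   Context: All sums are over non-negative integers $a_i$. $\mathcal H(U)$ is spanned by non-planar rooted forests (including the empty forest $\mathbf 1$) with vertices decorated by elements of $U$, modulo multilinearity; $|f|$ is the number of vertices. $\mathcal H_{\mathrm{CK}}(U)$ (Connes–Kreimer) has the disjoint union (forest) product and $\Delta_{\mathrm{CK}}f=\sum_Af|_A\otimes f|_{A^c}$, over vertex subsets $A$ closed under passing to descendants (upper part on the left). Primitives: $\mathcal P(U)=\{p:\Delta_{\mathrm{CK}}p=\mathbf 1\otimes p+p\otimes\mathbf 1\}$. Natural growth $\top$ is bilinear with $f\top\mathbf 1=f=\mathbf 1\top f$ and $f\top g=\frac1{|g|}\sum_v(\text{graft all roots of }f\text{ onto }v\in g)$ for non-empty forests. $p^{\top n}=p\top\cdots\top p$ ($n$ factors, bracketed from the left). A $V$-valued $\rho$-branched rough path $\mathbf X$ on $[0,T]$ controlled by $\omega$ assigns to $0\le s\le t\le T$ a linear functional $\langle\cdot,\mathbf X_{s,t}\rangle$ on the part of $\mathcal H_{\mathrm{CK}}(V^* )$ of weight $\le\lfloor\rho\rfloor$ that is multiplicative for the forest product with $\langle\mathbf 1,\mathbf X_{s,t}\rangle=1$, satisfies the Chen identity $\langle h,\mathbf X_{s,t}\rangle=\langle\Delta_{\mathrm{CK}}h,\mathbf X_{s,u}\otimes\mathbf X_{u,t}\rangle$, and $|\langle f,\mathbf X_{s,t}\rangle|=O(\omega(s,t)^{|f|/\rho})$. It extends uniquely to a multiplicative functional with the same properties on all of $\mathcal H_{\mathrm{CK}}(V^* )$ (its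 signature), also denoted $\mathbf X$. *)

theory Defs
  imports
    "HOL-Analysis.Analysis"
    "HOL-Library.Poly_Mapping"
    "HOL-Library.Extended_Nat"
begin

section \<open>Free real vector spaces\<close>

text \<open>
  The free real vector space on the elements of a type \<open>'a\<close> is the type \<open>'a \<Rightarrow>\<^sub>0 real\<close> of finitely
  supported functions; the library does not provide its scalar multiplication.
\<close>

instantiation poly_mapping :: (type, real_vector) real_vector
begin

lift_definition scaleR_poly_mapping :: "real \<Rightarrow> ('a \<Rightarrow>\<^sub>0 'b) \<Rightarrow> 'a \<Rightarrow>\<^sub>0 'b"
  is "\<lambda>c f x. c *\<^sub>R f x"
  by (rule finite_subset) auto

instance
  by standard (transfer; simp add: fun_eq_iff algebra_simps)+

end

definition lin_ext :: "('a \<Rightarrow> 'b::real_vector) \<Rightarrow> ('a \<Rightarrow>\<^sub>0 real) \<Rightarrow> 'b"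
  where "lin_ext \<phi> x = (\<Sum>a\<in>Poly_Mapping.keys x. Poly_Mapping.lookup x a *\<^sub>R \<phi> a)"

abbreviation gen :: "'a \<Rightarrow> 'a \<Rightarrow>\<^sub>0 real"
  where "gen a \<equiv> Poly_Mapping.single a 1"

lemma lookup_scaleR: "Poly_Mapping.lookup (c *\<^sub>R x) a = c *\<^sub>R Poly_Mapping.lookup x a"
  by transfer simp

lemma lin_ext_superset:
  assumes "finite A" "Poly_Mapping.keys x \<subseteq> A"
  shows "lin_ext \<phi> x = (\<Sum>a\<in>A. Poly_Mapping.lookup x a *\<^sub>R \<phi> a)"
  unfolding lin_ext_def using assms
  by (intro sum.mono_neutral_left) (auto simp: in_keys_iff)

lemma linear_lin_ext: "linear (lin_ext \<phi>)"
proof (rule linearI)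
  fix x y :: "'a \<Rightarrow>\<^sub>0 real" and c :: real
  let ?A = "Poly_Mapping.keys x \<union> Poly_Mapping.keys y"
  have "lin_ext \<phi> (x + y) = (\<Sum>a\<in>?A. Poly_Mapping.lookup (x + y) a *\<^sub>R \<phi> a)"
    by (intro lin_ext_superset) (auto simp: Poly_Mapping.keys_add)
  also have "\<dots> = (\<Sum>a\<in>?A. Poly_Mapping.lookup x a *\<^sub>R \<phi> a) + (\<Sum>a\<in>?A. Poly_Mapping.lookup y a *\<^sub>R \<phi> a)"
    by (simp add: lookup_add scaleR_add_left sum.distrib)
  also have "\<dots> = lin_ext \<phi> x + lin_ext \<phi> y"
    by (simp add: lin_ext_superset[of ?A])
  finally show "lin_ext \<phi> (x + y) = lin_ext \<phi> x + lin_ext \<phi> y" .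
  have "lin_ext \<phi> (c *\<^sub>R x) = (\<Sum>a\<in>Poly_Mapping.keys x. Poly_Mapping.lookup (c *\<^sub>R x) a *\<^sub>R \<phi> a)"
    by (intro lin_ext_superset) (auto simp: in_keys_iff lookup_scaleR)
  then show "lin_ext \<phi> (c *\<^sub>R x) = c *\<^sub>R lin_ext \<phi> x"
    by (simp add: lin_ext_def lookup_scaleR scaleR_sum_right)
qed

lemma lin_ext_gen [simp]: "lin_ext \<phi> (gen a) = \<phi> a"
  by (simp add: lin_ext_def)

lemma free_eq_sum: "x = (\<Sum>a\<in>Poly_Mapping.keys x. Poly_Mapping.lookup x a *\<^sub>R gen a)"
  by (rule poly_mapping_eqI)
     (auto simp: lookup_sum lookup_scaleR lookup_single when_def in_keys_iff if_distrib cong: if_cong)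

lemma span_gen: "span (range gen) = UNIV"
proof -
  have "x \<in> span (range gen)" for x :: "'a \<Rightarrow>\<^sub>0 real"
    by (subst free_eq_sum) (intro span_sum span_scale span_base rangeI)
  then show ?thesis by blast
qed

lemma lin_ext_cong_span:
  assumes "\<And>r. r \<in> R \<Longrightarrow> lin_ext \<phi> r = 0" "x - y \<in> span R"
  shows "lin_ext \<phi> x = lin_ext \<phi> y"
proof -
  have "lin_ext \<phi> (x - y) = 0"
    using linear_eq_0_on_span[OF linear_lin_ext] assms by blast
  then show ?thesis
    by (simp add: linear_diff[OF linear_lin_ext])
qed

lemma equivp_diff_span: "equivp (\<lambda>x y :: 'a::real_vector. x - y \<in> span R)"
proof (rule equivpI)
  show "reflp (\<lambda>x y :: 'a. x - y \<in> span R)"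
    by (simp add: reflp_def span_zero)
  show "symp (\<lambda>x y :: 'a. x - y \<in> span R)"
    using span_neg[of "_ - _ :: 'a" R] by (fastforce simp: symp_def)
  show "transp (\<lambda>x y :: 'a. x - y \<in> span R)"
  proof (rule transpI)
    fix x y z :: 'a
    assume "x - y \<in> span R" "y - z \<in> span R"
    then show "x - z \<in> span R"
      using span_add[of "x - y" R "y - z"] by simp
  qed
qed

lemma diff_span_add:
  "x - x' \<in> span R \<Longrightarrow> y - y' \<in> span R \<Longrightarrow> (x + y) - (x' + y') \<in> span R"
  by (simp add: add_diff_add span_add)

lemma diff_span_diff:
  "x - x' \<in> span R \<Longrightarrow> y - y' \<in> span R \<Longrightarrow> (x - y) - (x' - y') \<in> span R"
  using span_diff[of "x - x'" R "y - y'"] by (simp add: algebra_simps)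

lemma diff_span_minus: "x - x' \<in> span R \<Longrightarrow> (- x) - (- x') \<in> span R"
  using span_neg[of "x - x'" R] by simp

lemma diff_span_scale: "x - x' \<in> span R \<Longrightarrow> (c *\<^sub>R x) - (c *\<^sub>R x') \<in> span R"
  using span_scale[of "x - x'" R c] by (simp add: scaleR_diff_right)


section \<open>Tensor products of real vector spaces\<close>

definition tensor_relations :: "('a::real_vector \<times> 'b::real_vector \<Rightarrow>\<^sub>0 real) set"
  where "tensor_relations =
    {gen (x + x', y) - gen (x, y) - gen (x', y) | x x' y. True} \<union>
    {gen (x, y + y') - gen (x, y) - gen (x, y') | x y y'. True} \<union>
    {gen (c *\<^sub>R x, y) - c *\<^sub>R gen (x, y) | c x y. True} \<union>
    {gen (x, c *\<^sub>R y) - c *\<^sub>R gen (x, y) | c x y. True}"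

quotient_type (overloaded) ('a, 'b) tensor =
  "'a::real_vector \<times> 'b::real_vector \<Rightarrow>\<^sub>0 real" / "\<lambda>x y. x - y \<in> span tensor_relations"
  by (rule equivp_diff_span)

instantiation tensor :: (real_vector, real_vector) real_vector
begin

lift_definition zero_tensor :: "('a, 'b) tensor" is 0 .

lift_definition plus_tensor :: "('a, 'b) tensor \<Rightarrow> ('a, 'b) tensor \<Rightarrow> ('a, 'b) tensor" is "(+)"
  by (rule diff_span_add)

lift_definition uminus_tensor :: "('a, 'b) tensor \<Rightarrow> ('a, 'b) tensor" is uminus
  by (rule diff_span_minus)

lift_definition minus_tensor :: "('a, 'b) tensor \<Rightarrow> ('a, 'b) tensor \<Rightarrow> ('a, 'b) tensor" is "(-)"
  by (rule diff_span_diff)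

lift_definition scaleR_tensor :: "real \<Rightarrow> ('a, 'b) tensor \<Rightarrow> ('a, 'b) tensor" is scaleR
  by (rule diff_span_scale)

instance
  by standard (transfer; simp add: algebra_simps span_zero)+

end

lift_definition tensor_of :: "'a::real_vector \<Rightarrow> 'b::real_vector \<Rightarrow> ('a, 'b) tensor" (infixr "\<otimes>" 75)
  is "\<lambda>x y. gen (x, y)" .

definition tensor_lift ::
    "('a::real_vector \<Rightarrow> 'b::real_vector \<Rightarrow> 'c::real_vector) \<Rightarrow> ('a, 'b) tensor \<Rightarrow> 'c"
  where "tensor_lift \<beta> z = lin_ext (\<lambda>(x, y). \<beta> x y) (rep_tensor z)"

lemma linear_abs_tensor: "linear (abs_tensor :: _ \<Rightarrow> ('a::real_vector, 'b::real_vector) tensor)"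
  by (rule linearI) (simp_all add: plus_tensor.abs_eq scaleR_tensor.abs_eq)

lemma tensor_of_abs: "x \<otimes> y = abs_tensor (gen (x, y))"
  by (simp add: tensor_of.abs_eq)

lemma bilinear_tensor_of: "bilinear (\<otimes>)"
proof -
  have rel: "abs_tensor r = 0" if "r \<in> tensor_relations" for r :: "'a \<times> 'b \<Rightarrow>\<^sub>0 real"
    unfolding zero_tensor_def using that
    by (auto simp: tensor.abs_eq_iff intro: span_base)
  note l = linear_diff[OF linear_abs_tensor] linear_scale[OF linear_abs_tensor]
  have 1: "(x + x') \<otimes> y = x \<otimes> y + x' \<otimes> y" for x x' :: 'a and y :: 'b
  proof -
    have "gen (x + x', y) - gen (x, y) - gen (x', y) \<in> tensor_relations"
      unfolding tensor_relations_def by blast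
    from rel[OF this, unfolded l] show ?thesis
      unfolding tensor_of_abs by (simp add: algebra_simps)
  qed
  have 2: "x \<otimes> (y + y') = x \<otimes> y + x \<otimes> y'" for x :: 'a and y y' :: 'b
  proof -
    have "gen (x, y + y') - gen (x, y) - gen (x, y') \<in> tensor_relations"
      unfolding tensor_relations_def by blast
    from rel[OF this, unfolded l] show ?thesis
      unfolding tensor_of_abs by (simp add: algebra_simps)
  qed
  have 3: "(c *\<^sub>R x) \<otimes> y = c *\<^sub>R (x \<otimes> y)" for c and x :: 'a and y :: 'b
  proof -
    have "gen (c *\<^sub>R x, y) - c *\<^sub>R gen (x, y) \<in> tensor_relations"
      unfolding tensor_relations_def by blast
    from rel[OF this, unfolded l] show ?thesis
      unfolding tensor_of_abs by (simp add: algebra_simps)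
  qed
  have 4: "x \<otimes> (c *\<^sub>R y) = c *\<^sub>R (x \<otimes> y)" for c and x :: 'a and y :: 'b
  proof -
    have "gen (x, c *\<^sub>R y) - c *\<^sub>R gen (x, y) \<in> tensor_relations"
      unfolding tensor_relations_def by blast
    from rel[OF this, unfolded l] show ?thesis
      unfolding tensor_of_abs by (simp add: algebra_simps)
  qed
  show ?thesis
    unfolding bilinear_def by (auto intro!: linearI simp: 1 2 3 4)
qed

lemma tensor_lift_abs:
  assumes "bilinear \<beta>"
  shows "tensor_lift \<beta> (abs_tensor z) = lin_ext (\<lambda>(x, y). \<beta> x y) z"
proof -
  have "lin_ext (\<lambda>(x, y). \<beta> x y) r = 0" if "r \<in> tensor_relations" for r
    using that assms
    by (auto simp: tensor_relations_def linear_diff[OF linear_lin_ext] linear_scale[OF linear_lin_ext]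
        bilinear_ladd bilinear_radd bilinear_lmul bilinear_rmul)
  moreover have "rep_tensor (abs_tensor z) - z \<in> span tensor_relations"
    by (simp flip: tensor.abs_eq_iff add: Quotient3_abs_rep[OF Quotient3_tensor])
  ultimately show ?thesis
    unfolding tensor_lift_def by (rule lin_ext_cong_span)
qed

lemma tensor_lift_tensor_of [simp]: "bilinear \<beta> \<Longrightarrow> tensor_lift \<beta> (x \<otimes> y) = \<beta> x y"
  by (simp add: tensor_of_abs tensor_lift_abs)

lemma linear_tensor_lift:
  assumes "bilinear \<beta>"
  shows "linear (tensor_lift \<beta>)"
proof (rule linearI)
  fix z w :: "('a, 'b) tensor" and c :: real
  obtain z' w' where zw: "z = abs_tensor z'" "w = abs_tensor w'"
    by (metis Quotient3_abs_rep[OF Quotient3_tensor])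
  show "tensor_lift \<beta> (z + w) = tensor_lift \<beta> z + tensor_lift \<beta> w"
    by (simp add: zw plus_tensor.abs_eq tensor_lift_abs[OF assms] linear_add[OF linear_lin_ext])
  show "tensor_lift \<beta> (c *\<^sub>R z) = c *\<^sub>R tensor_lift \<beta> z"
    by (simp add: zw scaleR_tensor.abs_eq tensor_lift_abs[OF assms] linear_scale[OF linear_lin_ext])
qed

definition tensor_eval :: "('a::real_vector \<Rightarrow> real) \<Rightarrow> ('b::real_vector \<Rightarrow> real) \<Rightarrow> ('a, 'b) tensor \<Rightarrow> real"
  where "tensor_eval X Y = tensor_lift (\<lambda>x y. X x * Y y)"


section \<open>Decorated rooted forests\<close>

text \<open>
  A forest is represented on a concrete finite vertex set of natural numbers, by the partial map
  sending every non-root to its parent and by the decoration of the vertices (whose values off the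
  vertex set are irrelevant).  Non-planar forests are isomorphism classes of these; the passage to
  isomorphism classes is made in the quotient defining the space \<open>ck\<close> below.
\<close>

definition forest_shape :: "nat set \<Rightarrow> (nat \<rightharpoonup> nat) \<Rightarrow> bool"
  where "forest_shape V par \<longleftrightarrow>
    finite V \<and> dom par \<subseteq> V \<and> ran par \<subseteq> V \<and> acyclic {(w, v). par v = Some w}"

typedef 'u forest = "{(V, par, d :: nat \<Rightarrow> 'u). forest_shape V par}"
  by (auto intro!: exI[of _ "{}"] exI[of _ Map.empty] simp: forest_shape_def acyclic_def)

definition make_forest :: "nat set \<Rightarrow> (nat \<rightharpoonup> nat) \<Rightarrow> (nat \<Rightarrow> 'u) \<Rightarrow> 'u forest"
  where "make_forest V par d = Abs_forest (V, par, d)"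

definition verts :: "'u forest \<Rightarrow> nat set"
  where "verts f = fst (Rep_forest f)"

definition parent :: "'u forest \<Rightarrow> nat \<rightharpoonup> nat"
  where "parent f = fst (snd (Rep_forest f))"

definition decor :: "'u forest \<Rightarrow> nat \<Rightarrow> 'u"
  where "decor f = snd (snd (Rep_forest f))"

definition roots :: "'u forest \<Rightarrow> nat set"
  where "roots f = verts f - dom (parent f)"

abbreviation nverts :: "'u forest \<Rightarrow> nat"
  where "nverts f \<equiv> card (verts f)"

definition forest_iso :: "'u forest \<Rightarrow> 'u forest \<Rightarrow> bool"
  where "forest_iso f g \<longleftrightarrow> (\<exists>\<pi>. bij_betw \<pi> (verts f) (verts g) \<and>
    (\<forall>v\<in>verts f. parent g (\<pi> v) = map_option \<pi> (parent f v) \<and> decor g (\<pi> v) = decor f v))"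

definition redecorate :: "'u forest \<Rightarrow> nat \<Rightarrow> 'u \<Rightarrow> 'u forest"
  where "redecorate f v x = make_forest (verts f) (parent f) ((decor f)(v := x))"

definition empty_forest :: "'u forest"
  where "empty_forest = make_forest {} Map.empty (\<lambda>_. undefined)"

text \<open>The vertices of \<open>f\<close> become the even, those of \<open>g\<close> the odd numbers.\<close>

definition forest_union :: "'u forest \<Rightarrow> 'u forest \<Rightarrow> 'u forest"
  where "forest_union f g = make_forest
    ((\<lambda>i. 2 * i) ` verts f \<union> (\<lambda>i. 2 * i + 1) ` verts g)
    (\<lambda>u. if even u then map_option (\<lambda>i. 2 * i) (parent f (u div 2))
         else map_option (\<lambda>i. 2 * i + 1) (parent g (u div 2)))
    (\<lambda>u. if even u then decor f (u div 2) else decor g (u div 2))"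

text \<open>All roots of \<open>f\<close> become children of the vertex \<open>v\<close> of \<open>g\<close>; the vertices are numbered as in the
  disjoint union.\<close>

definition graft :: "'u forest \<Rightarrow> 'u forest \<Rightarrow> nat \<Rightarrow> 'u forest"
  where "graft f g v = make_forest
    (verts (forest_union f g))
    (\<lambda>u. if u \<in> (\<lambda>i. 2 * i) ` roots f then Some (2 * v + 1) else parent (forest_union f g) u)
    (decor (forest_union f g))"

definition restrict_forest :: "'u forest \<Rightarrow> nat set \<Rightarrow> 'u forest"
  where "restrict_forest f A = make_forest
    (verts f \<inter> A)
    (\<lambda>v. if v \<in> A then (case parent f v of None \<Rightarrow> None | Some w \<Rightarrow> if w \<in> A then Some w else None)
         else None)
    (decor f)"

definition descendant_closed :: "'u forest \<Rightarrow> nat set \<Rightarrow> bool"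
  where "descendant_closed f A \<longleftrightarrow>
    A \<subseteq> verts f \<and> (\<forall>v w. parent f w = Some v \<longrightarrow> v \<in> A \<longrightarrow> w \<in> A)"


subsection \<open>Well-formedness of the constructions\<close>

lemma forest_shapeI:
  assumes "finite V" "dom par \<subseteq> V" "ran par \<subseteq> V"
    and h: "\<And>v w. par v = Some w \<Longrightarrow> h w < (h v :: nat)"
  shows "forest_shape V par"
proof -
  have "{(w, v). par v = Some w} \<subseteq> inv_image less_than h"
    using h by auto
  then have "wf {(w, v). par v = Some w}"
    by (rule wf_subset[rotated]) simp
  then show ?thesis
    using assms by (simp add: forest_shape_def wf_acyclic)
qed

lemma forest_shape_rank:
  assumes "forest_shape V par"
  obtains h :: "nat \<Rightarrow> nat" where "\<And>v w. par v = Some w \<Longrightarrow> h w < h v"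
proof
  let ?r = "{(w, v). par v = Some w}"
  let ?h = "\<lambda>v. card {u. (u, v) \<in> ?r\<^sup>+}"
  have ac: "acyclic ?r" and "?r \<subseteq> V \<times> V" "finite V"
    using assms by (auto simp: forest_shape_def ran_def dom_def)
  then have r: "?r\<^sup>+ \<subseteq> V \<times> V"
    using trancl_subset_Sigma by metis
  fix v w assume "par v = Some w"
  then have wv: "(w, v) \<in> ?r" by simp
  have "{u. (u, v) \<in> ?r\<^sup>+} \<subseteq> V" using r by auto
  then have "finite {u. (u, v) \<in> ?r\<^sup>+}"
    using \<open>finite V\<close> finite_subset by blast
  moreover have "{u. (u, w) \<in> ?r\<^sup>+} \<subset> {u. (u, v) \<in> ?r\<^sup>+}"
  proof
    show "{u. (u, w) \<in> ?r\<^sup>+} \<subseteq> {u. (u, v) \<in> ?r\<^sup>+}"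
      using wv by (auto intro: trancl_into_trancl)
    have "w \<in> {u. (u, v) \<in> ?r\<^sup>+}" using wv by (auto intro: r_into_trancl)
    moreover have "w \<notin> {u. (u, w) \<in> ?r\<^sup>+}" using ac by (auto simp: acyclic_def)
    ultimately show "{u. (u, w) \<in> ?r\<^sup>+} \<noteq> {u. (u, v) \<in> ?r\<^sup>+}" by blast
  qed
  ultimately show "?h w < ?h v"
    by (rule psubset_card_mono)
qed

lemma forest_shape_forest: "forest_shape (verts f) (parent f)"
  using Rep_forest[of f] by (auto simp: verts_def parent_def)

lemma finite_verts [simp]: "finite (verts f)"
  using forest_shape_forest[of f] by (simp add: forest_shape_def)

lemma parent_in_verts: "parent f v = Some w \<Longrightarrow> v \<in> verts f \<and> w \<in> verts f"
  using forest_shape_forest[of f] by (auto simp: forest_shape_def dom_def ran_def)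

lemma forest_eqI: "verts f = verts g \<Longrightarrow> parent f = parent g \<Longrightarrow> decor f = decor g \<Longrightarrow> f = g"
  by (metis Rep_forest_inject decor_def parent_def prod.expand verts_def)

lemma make_forest_simps:
  assumes "forest_shape V par"
  shows "verts (make_forest V par d) = V" "parent (make_forest V par d) = par"
    "decor (make_forest V par d) = d"
  using assms by (simp_all add: make_forest_def verts_def parent_def decor_def Abs_forest_inverse)

lemma redecorate_simps [simp]:
  "verts (redecorate f v x) = verts f" "parent (redecorate f v x) = parent f"
  "decor (redecorate f v x) = (decor f)(v := x)"
  by (simp_all add: redecorate_def make_forest_simps forest_shape_forest)

lemma empty_forest_simps [simp]:
  "verts empty_forest = {}" "parent empty_forest = Map.empty"
  "decor empty_forest = (\<lambda>_. undefined)"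
proof -
  have "forest_shape {} (Map.empty :: nat \<rightharpoonup> nat)"
    by (rule forest_shapeI) auto
  then show "verts empty_forest = {}" "parent empty_forest = Map.empty"
    "decor empty_forest = (\<lambda>_. undefined)"
    by (simp_all add: empty_forest_def make_forest_simps)
qed

lemma forest_union_simps:
  "verts (forest_union f g) = (\<lambda>i. 2 * i) ` verts f \<union> (\<lambda>i. 2 * i + 1) ` verts g"
  "parent (forest_union f g) =
    (\<lambda>u. if even u then map_option (\<lambda>i. 2 * i) (parent f (u div 2))
         else map_option (\<lambda>i. 2 * i + 1) (parent g (u div 2)))"
  "decor (forest_union f g) = (\<lambda>u. if even u then decor f (u div 2) else decor g (u div 2))"
proof -
  obtain h k :: "nat \<Rightarrow> nat" where
    h: "\<And>v w. parent f v = Some w \<Longrightarrow> h w < h v" and k: "\<And>v w. parent g v = Some w \<Longrightarrow> k w < k v"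
    by (metis forest_shape_rank forest_shape_forest)
  have "forest_shape ((\<lambda>i. 2 * i) ` verts f \<union> (\<lambda>i. 2 * i + 1) ` verts g)
    (\<lambda>u. if even u then map_option (\<lambda>i. 2 * i) (parent f (u div 2))
         else map_option (\<lambda>i. 2 * i + 1) (parent g (u div 2)))"
    (is "forest_shape ?V ?par")
  proof (rule forest_shapeI[where h = "\<lambda>u. if even u then h (u div 2) else k (u div 2)"])
    have *: "u \<in> ?V \<and> w \<in> ?V" if "?par u = Some w" for u w
      using that by (cases "even u") (auto dest!: parent_in_verts elim!: evenE oddE)
    show "dom ?par \<subseteq> ?V" "ran ?par \<subseteq> ?V"
      unfolding dom_def ran_def using * by blast+
  qed (auto simp: h k split: if_splits)
  then show "verts (forest_union f g) = (\<lambda>i. 2 * i) ` verts f \<union> (\<lambda>i. 2 * i + 1) ` verts g"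
    "parent (forest_union f g) =
      (\<lambda>u. if even u then map_option (\<lambda>i. 2 * i) (parent f (u div 2))
           else map_option (\<lambda>i. 2 * i + 1) (parent g (u div 2)))"
    "decor (forest_union f g) = (\<lambda>u. if even u then decor f (u div 2) else decor g (u div 2))"
    by (simp_all add: forest_union_def make_forest_simps)
qed

lemma even_in_image_iff: "2 * i \<in> (\<lambda>i. 2 * i) ` A \<longleftrightarrow> (i :: nat) \<in> A"
  by auto

lemma odd_in_image_iff: "Suc (2 * i) \<in> (\<lambda>i. 2 * i) ` A \<longleftrightarrow> False"
  by (auto simp: image_iff) presburger

lemma graft_simps:
  assumes "v \<in> verts g"
  shows "verts (graft f g v) = verts (forest_union f g)"
  "parent (graft f g v) =
    (\<lambda>u. if u \<in> (\<lambda>i. 2 * i) ` roots f then Some (2 * v + 1) else parent (forest_union f g) u)"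
  "decor (graft f g v) = decor (forest_union f g)"
proof -
  obtain h k :: "nat \<Rightarrow> nat" where
    h: "\<And>v w. parent f v = Some w \<Longrightarrow> h w < h v" and k: "\<And>v w. parent g v = Some w \<Longrightarrow> k w < k v"
    by (metis forest_shape_rank forest_shape_forest)
  have "forest_shape (verts (forest_union f g))
    (\<lambda>u. if u \<in> (\<lambda>i. 2 * i) ` roots f then Some (2 * v + 1) else parent (forest_union f g) u)"
  proof (rule forest_shapeI[where h = "\<lambda>u. if even u then Suc (k v) + h (u div 2) else k (u div 2)"])
    show "dom (\<lambda>u. if u \<in> (\<lambda>i. 2 * i) ` roots f then Some (2 * v + 1) else parent (forest_union f g) u)
        \<subseteq> verts (forest_union f g)"
      using parent_in_verts[of "forest_union f g"]
      by (auto simp: dom_def roots_def forest_union_simps(1) split: if_splits)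
    show "ran (\<lambda>u. if u \<in> (\<lambda>i. 2 * i) ` roots f then Some (2 * v + 1) else parent (forest_union f g) u)
        \<subseteq> verts (forest_union f g)"
      using parent_in_verts[of "forest_union f g"] assms
      by (auto simp: ran_def forest_union_simps(1) split: if_splits)
  qed (auto simp: h k forest_union_simps(2) split: if_splits)
  then show "verts (graft f g v) = verts (forest_union f g)"
    "parent (graft f g v) =
      (\<lambda>u. if u \<in> (\<lambda>i. 2 * i) ` roots f then Some (2 * v + 1) else parent (forest_union f g) u)"
    "decor (graft f g v) = decor (forest_union f g)"
    by (simp_all add: graft_def make_forest_simps)
qed

lemma restrict_forest_simps:
  "verts (restrict_forest f A) = verts f \<inter> A"
  "parent (restrict_forest f A) =
    (\<lambda>v. if v \<in> A then (case parent f v of None \<Rightarrow> None | Some w \<Rightarrow> if w \<in> A then Some w else None)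
         else None)"
  "decor (restrict_forest f A) = decor f"
proof -
  obtain h :: "nat \<Rightarrow> nat" where h: "\<And>v w. parent f v = Some w \<Longrightarrow> h w < h v"
    by (metis forest_shape_rank forest_shape_forest)
  have "forest_shape (verts f \<inter> A)
    (\<lambda>v. if v \<in> A then (case parent f v of None \<Rightarrow> None | Some w \<Rightarrow> if w \<in> A then Some w else None)
         else None)"
    by (rule forest_shapeI[where h = h])
       (auto simp: dom_def ran_def h split: if_splits option.splits dest: parent_in_verts)
  then show "verts (restrict_forest f A) = verts f \<inter> A"
    "parent (restrict_forest f A) =
      (\<lambda>v. if v \<in> A then (case parent f v of None \<Rightarrow> None | Some w \<Rightarrow> if w \<in> A then Some w else None)
           else None)"
    "decor (restrict_forest f A) = decor f"
    by (simp_all add: restrict_forest_def make_forest_simps)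
qed


section \<open>The space of decorated forests\<close>

text \<open>
  \<open>'u ck\<close> is the space of non-planar forests decorated by \<open>'u\<close>: the quotient of the free vector space
  on concrete forests by isomorphism of forests and by linearity in the decoration of every vertex.
\<close>

definition forest_relations :: "('u::real_vector forest \<Rightarrow>\<^sub>0 real) set"
  where "forest_relations =
    {gen f - gen g | f g. forest_iso f g} \<union>
    {gen (redecorate f v (a *\<^sub>R x + b *\<^sub>R y)) - a *\<^sub>R gen (redecorate f v x) - b *\<^sub>R gen (redecorate f v y)
      | f v a x b y. v \<in> verts f}"

quotient_type (overloaded) 'u ck =
  "'u::real_vector forest \<Rightarrow>\<^sub>0 real" / "\<lambda>x y. x - y \<in> span forest_relations"
  by (rule equivp_diff_span)

instantiation ck :: (real_vector) real_vector
begin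

lift_definition zero_ck :: "'a ck" is 0 .

lift_definition plus_ck :: "'a ck \<Rightarrow> 'a ck \<Rightarrow> 'a ck" is "(+)"
  by (rule diff_span_add)

lift_definition uminus_ck :: "'a ck \<Rightarrow> 'a ck" is uminus
  by (rule diff_span_minus)

lift_definition minus_ck :: "'a ck \<Rightarrow> 'a ck \<Rightarrow> 'a ck" is "(-)"
  by (rule diff_span_diff)

lift_definition scaleR_ck :: "real \<Rightarrow> 'a ck \<Rightarrow> 'a ck" is scaleR
  by (rule diff_span_scale)

instance
  by standard (transfer; simp add: algebra_simps span_zero)+

end

lift_definition of_forest :: "'u::real_vector forest \<Rightarrow> 'u ck" is gen .

text \<open>
  Linear extension of a map on forests; it is meaningful only for maps compatible with
  \<open>forest_relations\<close>, which is checked below for every use.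
\<close>

definition ck_lift :: "('u::real_vector forest \<Rightarrow> 'b::real_vector) \<Rightarrow> 'u ck \<Rightarrow> 'b"
  where "ck_lift \<phi> h = lin_ext \<phi> (rep_ck h)"

definition ck_lift2 ::
    "('u::real_vector forest \<Rightarrow> 'u forest \<Rightarrow> 'b::real_vector) \<Rightarrow> 'u ck \<Rightarrow> 'u ck \<Rightarrow> 'b"
  where "ck_lift2 \<phi> h k = ck_lift (\<lambda>f. ck_lift (\<phi> f) k) h"

definition compatible :: "('u::real_vector forest \<Rightarrow> 'b::real_vector) \<Rightarrow> bool"
  where "compatible \<phi> \<longleftrightarrow>
    (\<forall>f g. forest_iso f g \<longrightarrow> \<phi> f = \<phi> g) \<and>
    (\<forall>f v a x b y. v \<in> verts f \<longrightarrow>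
      \<phi> (redecorate f v (a *\<^sub>R x + b *\<^sub>R y)) = a *\<^sub>R \<phi> (redecorate f v x) + b *\<^sub>R \<phi> (redecorate f v y))"

lemma compatibleI:
  assumes "\<And>f g. forest_iso f g \<Longrightarrow> \<phi> f = \<phi> g"
    and "\<And>f v a x b y. v \<in> verts f \<Longrightarrow>
      \<phi> (redecorate f v (a *\<^sub>R x + b *\<^sub>R y)) = a *\<^sub>R \<phi> (redecorate f v x) + b *\<^sub>R \<phi> (redecorate f v y)"
  shows "compatible \<phi>"
  using assms unfolding compatible_def by blast

lemma compatible_iso: "compatible \<phi> \<Longrightarrow> forest_iso f g \<Longrightarrow> \<phi> f = \<phi> g"
  by (simp add: compatible_def)

lemma compatible_redecorate:
  "compatible \<phi> \<Longrightarrow> v \<in> verts f \<Longrightarrow>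
    \<phi> (redecorate f v (a *\<^sub>R x + b *\<^sub>R y)) = a *\<^sub>R \<phi> (redecorate f v x) + b *\<^sub>R \<phi> (redecorate f v y)"
  by (simp add: compatible_def)

lemma linear_abs_ck: "linear (abs_ck :: _ \<Rightarrow> 'u::real_vector ck)"
  by (rule linearI) (simp_all add: plus_ck.abs_eq scaleR_ck.abs_eq)

lemma of_forest_abs: "of_forest f = abs_ck (gen f)"
  by (simp add: of_forest.abs_eq)

lemma compatible_of_forest: "compatible (of_forest :: 'u::real_vector forest \<Rightarrow> 'u ck)"
proof -
  have rel: "abs_ck r = 0" if "r \<in> forest_relations" for r :: "'u forest \<Rightarrow>\<^sub>0 real"
    unfolding zero_ck_def using that by (auto simp: ck.abs_eq_iff intro: span_base)
  note l = linear_diff[OF linear_abs_ck] linear_scale[OF linear_abs_ck]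
  show ?thesis
  proof (rule compatibleI)
    fix f g :: "'u forest" assume "forest_iso f g"
    then have "gen f - gen g \<in> forest_relations"
      unfolding forest_relations_def by blast
    from rel[OF this, unfolded l] show "of_forest f = of_forest g"
      by (simp add: of_forest_abs)
  next
    fix f :: "'u forest" and v a x b y assume "v \<in> verts f"
    then have "gen (redecorate f v (a *\<^sub>R x + b *\<^sub>R y)) - a *\<^sub>R gen (redecorate f v x)
        - b *\<^sub>R gen (redecorate f v y) \<in> forest_relations"
      unfolding forest_relations_def by blast
    from rel[OF this, unfolded l]
    show "of_forest (redecorate f v (a *\<^sub>R x + b *\<^sub>R y)) =
        a *\<^sub>R of_forest (redecorate f v x) + b *\<^sub>R of_forest (redecorate f v y)"
      unfolding of_forest_abs by (simp add: algebra_simps)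
  qed
qed

lemma ck_lift_abs:
  assumes "compatible \<phi>"
  shows "ck_lift \<phi> (abs_ck z) = lin_ext \<phi> z"
proof -
  have "lin_ext \<phi> r = 0" if "r \<in> forest_relations" for r
    using that assms
    by (auto simp: forest_relations_def linear_diff[OF linear_lin_ext] linear_scale[OF linear_lin_ext]
        compatible_redecorate dest: compatible_iso)
  moreover have "rep_ck (abs_ck z) - z \<in> span forest_relations"
    by (simp flip: ck.abs_eq_iff add: Quotient3_abs_rep[OF Quotient3_ck])
  ultimately show ?thesis
    unfolding ck_lift_def by (rule lin_ext_cong_span)
qed

lemma ck_lift_of_forest [simp]: "compatible \<phi> \<Longrightarrow> ck_lift \<phi> (of_forest f) = \<phi> f"
  by (simp add: of_forest_abs ck_lift_abs)

lemma linear_ck_lift: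
  assumes "compatible \<phi>"
  shows "linear (ck_lift \<phi>)"
proof (rule linearI)
  fix z w :: "'a::real_vector ck" and c :: real
  obtain z' w' where zw: "z = abs_ck z'" "w = abs_ck w'"
    by (metis Quotient3_abs_rep[OF Quotient3_ck])
  show "ck_lift \<phi> (z + w) = ck_lift \<phi> z + ck_lift \<phi> w"
    by (simp add: zw plus_ck.abs_eq ck_lift_abs[OF assms] linear_add[OF linear_lin_ext])
  show "ck_lift \<phi> (c *\<^sub>R z) = c *\<^sub>R ck_lift \<phi> z"
    by (simp add: zw scaleR_ck.abs_eq ck_lift_abs[OF assms] linear_scale[OF linear_lin_ext])
qed

lemma span_of_forest: "span (range of_forest) = UNIV"
proof -
  have "z \<in> span (range of_forest)" for z :: "'a::real_vector ck"
  proof -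
    obtain z' where "z = abs_ck z'"
      by (metis Quotient3_abs_rep[OF Quotient3_ck])
    moreover have "abs_ck z' \<in> span (abs_ck ` range gen)"
      using linear_span_image[OF linear_abs_ck] span_gen by (metis UNIV_I image_eqI)
    ultimately show ?thesis
      by (simp add: image_image of_forest_abs)
  qed
  then show ?thesis by blast
qed

lemma ck_linear_eqI:
  assumes "linear F" "linear G" "\<And>f. F (of_forest f) = G (of_forest f)"
  shows "F z = G z"
  using linear_eq_on[OF assms(1,2), of z "range of_forest"] assms(3) span_of_forest by auto

lemma compatible_ck_lift:
  fixes \<phi> :: "'a::real_vector forest \<Rightarrow> 'b::real_vector forest \<Rightarrow> 'c::real_vector"
  assumes "\<And>g. compatible (\<lambda>f. \<phi> f g)"
  shows "compatible (\<lambda>f. ck_lift (\<phi> f) k)"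
proof (rule compatibleI)
  fix f g :: "'a forest" assume "forest_iso f g"
  then have "\<phi> f = \<phi> g"
    using compatible_iso[OF assms] by blast
  then show "ck_lift (\<phi> f) k = ck_lift (\<phi> g) k" by simp
next
  fix f :: "'a forest" and v a x b y assume "v \<in> verts f"
  then have "\<phi> (redecorate f v (a *\<^sub>R x + b *\<^sub>R y)) =
      (\<lambda>g. a *\<^sub>R \<phi> (redecorate f v x) g + b *\<^sub>R \<phi> (redecorate f v y) g)"
    using compatible_redecorate[OF assms] by blast
  then show "ck_lift (\<phi> (redecorate f v (a *\<^sub>R x + b *\<^sub>R y))) k =
      a *\<^sub>R ck_lift (\<phi> (redecorate f v x)) k + b *\<^sub>R ck_lift (\<phi> (redecorate f v y)) k"
    by (simp add: ck_lift_def lin_ext_def scaleR_add_right sum.distrib scaleR_sum_right mult.commute)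
qed

lemma bilinear_ck_lift2:
  fixes \<phi> :: "'a::real_vector forest \<Rightarrow> 'a forest \<Rightarrow> 'c::real_vector"
  assumes "\<And>f. compatible (\<phi> f)" "\<And>g. compatible (\<lambda>f. \<phi> f g)"
  shows "bilinear (ck_lift2 \<phi>)"
proof -
  have "linear (\<lambda>k. ck_lift2 \<phi> h k)" for h
  proof (rule linearI)
    fix k l :: "'a ck" and c :: real
    show "ck_lift2 \<phi> h (k + l) = ck_lift2 \<phi> h k + ck_lift2 \<phi> h l"
      unfolding ck_lift2_def linear_add[OF linear_ck_lift[OF assms(1)]]
      by (simp add: ck_lift_def[of _ h] lin_ext_def scaleR_add_right sum.distrib)
    show "ck_lift2 \<phi> h (c *\<^sub>R k) = c *\<^sub>R ck_lift2 \<phi> h k"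
      unfolding ck_lift2_def linear_scale[OF linear_ck_lift[OF assms(1)]]
      by (simp add: ck_lift_def[of _ h] lin_ext_def scaleR_sum_right mult.commute)
  qed
  moreover have "linear (\<lambda>h. ck_lift2 \<phi> h k)" for k
    unfolding ck_lift2_def
    by (intro linear_ck_lift compatible_ck_lift assms)
  ultimately show ?thesis
    by (simp add: bilinear_def)
qed

lemma ck_lift2_of_forest:
  assumes "\<And>f. compatible (\<phi> f)" "\<And>g. compatible (\<lambda>f. \<phi> f g)"
  shows "ck_lift2 \<phi> (of_forest f) (of_forest g) = \<phi> f g"
  by (simp add: ck_lift2_def ck_lift_of_forest[OF compatible_ck_lift] assms)


section \<open>The Connes-Kreimer operations\<close>

definition forest_coproduct :: "'u::real_vector forest \<Rightarrow> ('u ck, 'u ck) tensor"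
  where "forest_coproduct f = (\<Sum>A | descendant_closed f A.
    of_forest (restrict_forest f A) \<otimes> of_forest (restrict_forest f (verts f - A)))"

definition coproduct :: "'u::real_vector ck \<Rightarrow> ('u ck, 'u ck) tensor"
  where "coproduct = ck_lift forest_coproduct"

definition forest_growth :: "'u::real_vector forest \<Rightarrow> 'u forest \<Rightarrow> 'u ck"
  where "forest_growth f g =
    (if verts f = {} then of_forest g
     else if verts g = {} then of_forest f
     else (1 / real (nverts g)) *\<^sub>R (\<Sum>v\<in>verts g. of_forest (graft f g v)))"

definition growth :: "'u::real_vector ck \<Rightarrow> 'u ck \<Rightarrow> 'u ck" (infixl "\<top>" 72)
  where "growth = ck_lift2 forest_growth"


subsection \<open>Compatibility with the relations\<close>

definition iso_via :: "(nat \<Rightarrow> nat) \<Rightarrow> 'u forest \<Rightarrow> 'u forest \<Rightarrow> bool"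
  where "iso_via \<pi> f g \<longleftrightarrow> bij_betw \<pi> (verts f) (verts g) \<and>
    (\<forall>v\<in>verts f. parent g (\<pi> v) = map_option \<pi> (parent f v) \<and> decor g (\<pi> v) = decor f v)"

lemma forest_iso_iff: "forest_iso f g \<longleftrightarrow> (\<exists>\<pi>. iso_via \<pi> f g)"
  by (simp add: forest_iso_def iso_via_def)

lemma iso_viaD:
  assumes "iso_via \<pi> f g"
  shows "bij_betw \<pi> (verts f) (verts g)" "inj_on \<pi> (verts f)" "verts g = \<pi> ` verts f"
    "v \<in> verts f \<Longrightarrow> parent g (\<pi> v) = map_option \<pi> (parent f v)"
    "v \<in> verts f \<Longrightarrow> decor g (\<pi> v) = decor f v"
  using assms by (auto simp: iso_via_def bij_betw_def)

lemma iso_viaI: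
  assumes "inj_on \<pi> (verts f)" "\<pi> ` verts f = verts g"
    "\<And>v. v \<in> verts f \<Longrightarrow> parent g (\<pi> v) = map_option \<pi> (parent f v)"
    "\<And>v. v \<in> verts f \<Longrightarrow> decor g (\<pi> v) = decor f v"
  shows "iso_via \<pi> f g"
  using assms by (auto simp: iso_via_def bij_betw_def)

lemma forest_isoI: "iso_via \<pi> f g \<Longrightarrow> forest_iso f g"
  by (auto simp: forest_iso_iff)

lemma iso_via_id: "iso_via (\<lambda>v. v) f f"
  by (rule iso_viaI) (auto simp: option.map_ident)

definition sum_map :: "(nat \<Rightarrow> nat) \<Rightarrow> (nat \<Rightarrow> nat) \<Rightarrow> nat \<Rightarrow> nat"
  where "sum_map \<pi> \<sigma> u = (if even u then 2 * \<pi> (u div 2) else 2 * \<sigma> (u div 2) + 1)"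

lemma sum_map_simps [simp]: "sum_map \<pi> \<sigma> (2 * i) = 2 * \<pi> i" "sum_map \<pi> \<sigma> (Suc (2 * i)) = Suc (2 * \<sigma> i)"
  by (simp_all add: sum_map_def)

lemma double_neq_Suc_double [simp]: "2 * i \<noteq> Suc (2 * j)" "Suc (2 * j) \<noteq> 2 * i" for i j :: nat
  by presburger+

lemma parent_union [simp]:
  "parent (forest_union f g) (2 * i) = map_option (\<lambda>i. 2 * i) (parent f i)"
  "parent (forest_union f g) (Suc (2 * i)) = map_option (\<lambda>i. Suc (2 * i)) (parent g i)"
  by (simp_all add: forest_union_simps)

lemma decor_union [simp]:
  "decor (forest_union f g) (2 * i) = decor f i"
  "decor (forest_union f g) (Suc (2 * i)) = decor g i"
  by (simp_all add: forest_union_simps)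

lemma verts_union: "verts (forest_union f g) = (\<lambda>i. 2 * i) ` verts f \<union> (\<lambda>i. Suc (2 * i)) ` verts g"
  by (simp add: forest_union_simps)

lemma iso_via_union:
  assumes "iso_via \<pi> f f'" "iso_via \<sigma> g g'"
  shows "iso_via (sum_map \<pi> \<sigma>) (forest_union f g) (forest_union f' g')"
proof (rule iso_viaI)
  show "inj_on (sum_map \<pi> \<sigma>) (verts (forest_union f g))"
    unfolding verts_union
    by (rule inj_onI) (auto dest: inj_onD[OF iso_viaD(2)[OF assms(1)]] inj_onD[OF iso_viaD(2)[OF assms(2)]])
  show "sum_map \<pi> \<sigma> ` verts (forest_union f g) = verts (forest_union f' g')"
    by (simp add: verts_union iso_viaD(3)[OF assms(1)] iso_viaD(3)[OF assms(2)] image_Un image_image)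
next
  fix v assume "v \<in> verts (forest_union f g)"
  then consider i where "v = 2 * i" "i \<in> verts f" | i where "v = Suc (2 * i)" "i \<in> verts g"
    by (auto simp: verts_union)
  then have "parent (forest_union f' g') (sum_map \<pi> \<sigma> v) =
        map_option (sum_map \<pi> \<sigma>) (parent (forest_union f g) v) \<and>
      decor (forest_union f' g') (sum_map \<pi> \<sigma> v) = decor (forest_union f g) v"
    by cases (simp_all add: iso_viaD(4,5)[OF assms(1)] iso_viaD(4,5)[OF assms(2)] option.map_comp comp_def)
  then show "parent (forest_union f' g') (sum_map \<pi> \<sigma> v) =
      map_option (sum_map \<pi> \<sigma>) (parent (forest_union f g) v)"
    "decor (forest_union f' g') (sum_map \<pi> \<sigma> v) = decor (forest_union f g) v"
    by simp_all
qed

lemma roots_iso: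
  assumes "iso_via \<pi> f f'" "i \<in> verts f"
  shows "\<pi> i \<in> roots f' \<longleftrightarrow> i \<in> roots f"
  using assms(2) iso_viaD(3,4)[OF assms(1)] by (auto simp: roots_def dom_def)

lemma parent_graft:
  assumes "v \<in> verts g"
  shows "parent (graft f g v) (2 * i) = (if i \<in> roots f then Some (Suc (2 * v)) else parent (forest_union f g) (2 * i))"
    "parent (graft f g v) (Suc (2 * i)) = parent (forest_union f g) (Suc (2 * i))"
  by (auto simp: graft_simps[OF assms] image_iff simp del: parent_union)

lemma iso_via_graft:
  assumes "iso_via \<pi> f f'" "iso_via \<sigma> g g'" "v \<in> verts g"
  shows "iso_via (sum_map \<pi> \<sigma>) (graft f g v) (graft f' g' (\<sigma> v))"
proof -
  note u = iso_via_union[OF assms(1,2)]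
  have v': "\<sigma> v \<in> verts g'" using assms iso_viaD(3) by blast
  show ?thesis
  proof (rule iso_viaI)
    show "inj_on (sum_map \<pi> \<sigma>) (verts (graft f g v))"
      using iso_viaD(2)[OF u] by (simp add: graft_simps assms)
    show "sum_map \<pi> \<sigma> ` verts (graft f g v) = verts (graft f' g' (\<sigma> v))"
      using iso_viaD(3)[OF u] by (simp add: graft_simps assms v')
  next
    fix w assume "w \<in> verts (graft f g v)"
    then have w: "w \<in> verts (forest_union f g)" by (simp add: graft_simps assms)
    then show "parent (graft f' g' (\<sigma> v)) (sum_map \<pi> \<sigma> w) =
        map_option (sum_map \<pi> \<sigma>) (parent (graft f g v) w)"
      using iso_viaD(4)[OF u w]
      by (auto simp: verts_union parent_graft[OF assms(3)] parent_graft[OF v'] roots_iso[OF assms(1)])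
    show "decor (graft f' g' (\<sigma> v)) (sum_map \<pi> \<sigma> w) = decor (graft f g v) w"
      using iso_viaD(5)[OF u w] by (simp add: graft_simps assms v')
  qed
qed

lemma redecorate_union_left:
  "forest_union (redecorate f v x) g = redecorate (forest_union f g) (2 * v) x"
  by (rule forest_eqI) (auto simp: forest_union_simps fun_eq_iff elim!: evenE)

lemma redecorate_union_right:
  "forest_union f (redecorate g v x) = redecorate (forest_union f g) (Suc (2 * v)) x"
  by (rule forest_eqI) (auto simp: forest_union_simps fun_eq_iff elim!: oddE)

lemma roots_redecorate [simp]: "roots (redecorate f v x) = roots f"
  by (simp add: roots_def)

lemma redecorate_graft_left:
  "w \<in> verts g \<Longrightarrow> graft (redecorate f v x) g w = redecorate (graft f g w) (2 * v) x"
  by (rule forest_eqI) (simp_all add: graft_simps redecorate_union_left cong: if_cong)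

lemma redecorate_graft_right:
  "w \<in> verts g \<Longrightarrow> graft f (redecorate g v x) w = redecorate (graft f g w) (Suc (2 * v)) x"
  by (rule forest_eqI) (simp_all add: graft_simps redecorate_union_right cong: if_cong)

lemma compatible_union_left: "compatible (\<lambda>f :: 'u::real_vector forest. of_forest (forest_union f g))"
proof (rule compatibleI)
  fix f f' :: "'u forest" assume "forest_iso f f'"
  then show "of_forest (forest_union f g) = of_forest (forest_union f' g)"
    using iso_via_union[OF _ iso_via_id] compatible_iso[OF compatible_of_forest]
    unfolding forest_iso_iff by blast
next
  fix f :: "'u forest" and v a x b y assume "v \<in> verts f"
  then show "of_forest (forest_union (redecorate f v (a *\<^sub>R x + b *\<^sub>R y)) g) =
      a *\<^sub>R of_forest (forest_union (redecorate f v x) g) + b *\<^sub>R of_forest (forest_union (redecorate f v y) g)"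
    unfolding redecorate_union_left
    by (intro compatible_redecorate[OF compatible_of_forest]) (simp add: verts_union)
qed

lemma compatible_union_right: "compatible (\<lambda>g :: 'u::real_vector forest. of_forest (forest_union f g))"
proof (rule compatibleI)
  fix g g' :: "'u forest" assume "forest_iso g g'"
  then show "of_forest (forest_union f g) = of_forest (forest_union f g')"
    using iso_via_union[OF iso_via_id] compatible_iso[OF compatible_of_forest]
    unfolding forest_iso_iff by blast
next
  fix g :: "'u forest" and v a x b y assume "v \<in> verts g"
  then show "of_forest (forest_union f (redecorate g v (a *\<^sub>R x + b *\<^sub>R y))) =
      a *\<^sub>R of_forest (forest_union f (redecorate g v x)) + b *\<^sub>R of_forest (forest_union f (redecorate g v y))"
    unfolding redecorate_union_right
    by (intro compatible_redecorate[OF compatible_of_forest]) (simp add: verts_union)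
qed

lemma compatible_growth_left: "compatible (\<lambda>f :: 'u::real_vector forest. forest_growth f g)"
proof (rule compatibleI)
  fix f f' :: "'u forest" assume iso: "forest_iso f f'"
  then obtain \<pi> where \<pi>: "iso_via \<pi> f f'" by (auto simp: forest_iso_iff)
  have "of_forest (graft f g v) = of_forest (graft f' g v)" if "v \<in> verts g" for v
    using iso_via_graft[OF \<pi> iso_via_id that] compatible_iso[OF compatible_of_forest] forest_isoI by blast
  moreover have "of_forest f = of_forest f'"
    using compatible_iso[OF compatible_of_forest iso] .
  moreover have "verts f = {} \<longleftrightarrow> verts f' = {}"
    using iso_viaD(3)[OF \<pi>] by simp
  ultimately show "forest_growth f g = forest_growth f' g"
    by (simp add: forest_growth_def)
next
  fix f :: "'u forest" and v a x b y assume v: "v \<in> verts f"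
  have "of_forest (graft (redecorate f v (a *\<^sub>R x + b *\<^sub>R y)) g w) =
      a *\<^sub>R of_forest (graft (redecorate f v x) g w) + b *\<^sub>R of_forest (graft (redecorate f v y) g w)"
    if "w \<in> verts g" for w
    unfolding redecorate_graft_left[OF that] using v that
    by (intro compatible_redecorate[OF compatible_of_forest]) (simp add: graft_simps verts_union)
  then show "forest_growth (redecorate f v (a *\<^sub>R x + b *\<^sub>R y)) g =
      a *\<^sub>R forest_growth (redecorate f v x) g + b *\<^sub>R forest_growth (redecorate f v y) g"
    using v compatible_redecorate[OF compatible_of_forest v]
    by (auto simp: forest_growth_def sum.distrib scaleR_add_right scaleR_sum_right mult.commute)
qed

lemma compatible_growth_right: "compatible (\<lambda>g :: 'u::real_vector forest. forest_growth f g)"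
proof (rule compatibleI)
  fix g g' :: "'u forest" assume iso: "forest_iso g g'"
  then obtain \<sigma> where \<sigma>: "iso_via \<sigma> g g'" by (auto simp: forest_iso_iff)
  have "of_forest (graft f g v) = of_forest (graft f g' (\<sigma> v))" if "v \<in> verts g" for v
    using iso_via_graft[OF iso_via_id \<sigma> that] compatible_iso[OF compatible_of_forest] forest_isoI by blast
  then have "(\<Sum>v\<in>verts g. of_forest (graft f g v)) = (\<Sum>v\<in>verts g. of_forest (graft f g' (\<sigma> v)))"
    by simp
  also have "\<dots> = (\<Sum>v\<in>verts g'. of_forest (graft f g' v))"
    by (rule sum.reindex_bij_betw[OF iso_viaD(1)[OF \<sigma>]])
  finally have "(\<Sum>v\<in>verts g. of_forest (graft f g v)) = (\<Sum>v\<in>verts g'. of_forest (graft f g' v))" .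
  moreover have "of_forest g = of_forest g'"
    using compatible_iso[OF compatible_of_forest iso] .
  moreover have "verts g = {} \<longleftrightarrow> verts g' = {}"
    using iso_viaD(3)[OF \<sigma>] by simp
  moreover have "nverts g = nverts g'"
    using bij_betw_same_card[OF iso_viaD(1)[OF \<sigma>]] .
  ultimately show "forest_growth f g = forest_growth f g'"
    by (simp add: forest_growth_def)
next
  fix g :: "'u forest" and v a x b y assume v: "v \<in> verts g"
  have "of_forest (graft f (redecorate g v (a *\<^sub>R x + b *\<^sub>R y)) w) =
      a *\<^sub>R of_forest (graft f (redecorate g v x) w) + b *\<^sub>R of_forest (graft f (redecorate g v y) w)"
    if "w \<in> verts g" for w
    unfolding redecorate_graft_right[OF that] using v that
    by (intro compatible_redecorate[OF compatible_of_forest]) (simp add: graft_simps verts_union)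
  then show "forest_growth f (redecorate g v (a *\<^sub>R x + b *\<^sub>R y)) =
      a *\<^sub>R forest_growth f (redecorate g v x) + b *\<^sub>R forest_growth f (redecorate g v y)"
    using v compatible_redecorate[OF compatible_of_forest v]
    by (auto simp: forest_growth_def sum.distrib scaleR_add_right scaleR_sum_right mult.commute)
qed

lemma finite_descendant_closed [simp]: "finite {A. descendant_closed f A}"
  by (rule finite_subset[of _ "Pow (verts f)"]) (auto simp: descendant_closed_def)

lemma iso_via_restrict:
  assumes "iso_via \<pi> f g" "A \<subseteq> verts f"
  shows "iso_via \<pi> (restrict_forest f A) (restrict_forest g (\<pi> ` A))"
proof -
  have inj: "\<pi> w \<in> \<pi> ` A \<longleftrightarrow> w \<in> A" if "w \<in> verts f" for w
    using that assms(2) iso_viaD(2)[OF assms(1)] by (metis inj_on_image_mem_iff)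
  show ?thesis
  proof (rule iso_viaI)
    show "inj_on \<pi> (verts (restrict_forest f A))"
      using iso_viaD(2)[OF assms(1)] by (auto simp: restrict_forest_simps inj_on_def)
    show "\<pi> ` verts (restrict_forest f A) = verts (restrict_forest g (\<pi> ` A))"
      using iso_viaD(3)[OF assms(1)] assms(2) by (auto simp: restrict_forest_simps)
  next
    fix v assume "v \<in> verts (restrict_forest f A)"
    then have v: "v \<in> verts f" "v \<in> A" by (auto simp: restrict_forest_simps)
    show "parent (restrict_forest g (\<pi> ` A)) (\<pi> v) = map_option \<pi> (parent (restrict_forest f A) v)"
    proof (cases "parent f v")
      case None
      then show ?thesis
        using iso_viaD(4)[OF assms(1) v(1)] by (simp add: restrict_forest_simps)
    next
      case (Some w)
      then have "w \<in> verts f" by (blast dest: parent_in_verts)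
      then show ?thesis
        using Some v iso_viaD(4)[OF assms(1) v(1)] by (simp add: restrict_forest_simps inj)
    qed
    show "decor (restrict_forest g (\<pi> ` A)) (\<pi> v) = decor (restrict_forest f A) v"
      using iso_viaD(5)[OF assms(1) v(1)] by (simp add: restrict_forest_simps)
  qed
qed

lemma descendant_closed_iso:
  assumes "iso_via \<pi> f g" "A \<subseteq> verts f"
  shows "descendant_closed g (\<pi> ` A) \<longleftrightarrow> descendant_closed f A"
proof -
  have inj: "\<pi> w \<in> \<pi> ` A \<longleftrightarrow> w \<in> A" if "w \<in> verts f" for w
    using that assms(2) iso_viaD(2)[OF assms(1)] by (metis inj_on_image_mem_iff)
  have inj2: "\<pi> v = \<pi> w \<longleftrightarrow> v = w" if "v \<in> verts f" "w \<in> verts f" for v w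
    using that iso_viaD(2)[OF assms(1)] by (auto simp: inj_on_def)
  show ?thesis
  proof
    assume g: "descendant_closed g (\<pi> ` A)"
    show "descendant_closed f A"
      unfolding descendant_closed_def
    proof (intro conjI allI impI assms(2))
      fix v w assume vw: "parent f w = Some v" "v \<in> A"
      then have "w \<in> verts f" by (blast dest: parent_in_verts)
      moreover from this have "parent g (\<pi> w) = Some (\<pi> v)"
        using iso_viaD(4)[OF assms(1)] vw by simp
      ultimately show "w \<in> A"
        using g vw(2) inj unfolding descendant_closed_def by blast
    qed
  next
    assume f: "descendant_closed f A"
    show "descendant_closed g (\<pi> ` A)"
      unfolding descendant_closed_def
    proof (intro conjI allI impI)
      show "\<pi> ` A \<subseteq> verts g" using assms(2) iso_viaD(3)[OF assms(1)] by auto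
      fix v' w' assume vw: "parent g w' = Some v'" "v' \<in> \<pi> ` A"
      then obtain w where w: "w \<in> verts f" "w' = \<pi> w"
        using iso_viaD(3)[OF assms(1)] by (blast dest: parent_in_verts)
      then obtain v where v: "parent f w = Some v" "v' = \<pi> v"
        using vw(1) iso_viaD(4)[OF assms(1) w(1)] by auto
      then have "v \<in> A" using vw(2) inj by (blast dest: parent_in_verts)
      then show "w' \<in> \<pi> ` A" using f v w unfolding descendant_closed_def by blast
    qed
  qed
qed

lemma restrict_redecorate: "restrict_forest (redecorate f v x) A = redecorate (restrict_forest f A) v x"
  by (rule forest_eqI) (simp_all add: restrict_forest_simps cong: if_cong)

lemma iso_redecorate_outside: "v \<notin> verts f \<Longrightarrow> forest_iso (redecorate f v x) f"
  by (rule forest_isoI[of "\<lambda>v. v"], rule iso_viaI) (auto simp: option.map_ident)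

lemma compatible_coproduct: "compatible (forest_coproduct :: 'u::real_vector forest \<Rightarrow> _)"
proof (rule compatibleI)
  fix f g :: "'u forest" assume "forest_iso f g"
  then obtain \<pi> where \<pi>: "iso_via \<pi> f g" by (auto simp: forest_iso_iff)
  let ?t = "\<lambda>f A. of_forest (restrict_forest f A) \<otimes> of_forest (restrict_forest f (verts f - A)) :: ('u ck, 'u ck) tensor"
  have "bij_betw (image \<pi>) {A \<in> Pow (verts f). descendant_closed f A} {A \<in> Pow (verts g). descendant_closed g A}"
    by (rule bij_betw_Collect[OF bij_betw_Pow[OF iso_viaD(1)[OF \<pi>]]])
       (simp add: descendant_closed_iso[OF \<pi>])
  moreover have "{A \<in> Pow (verts h). descendant_closed h A} = {A. descendant_closed h A}" for h :: "'u forest"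
    by (auto simp: descendant_closed_def)
  ultimately have bij: "bij_betw (image \<pi>) {A. descendant_closed f A} {A. descendant_closed g A}"
    by simp
  have "?t f A = ?t g (\<pi> ` A)" if "descendant_closed f A" for A
  proof -
    have A: "A \<subseteq> verts f" using that by (simp add: descendant_closed_def)
    have "verts g - \<pi> ` A = \<pi> ` (verts f - A)"
      using iso_viaD(2,3)[OF \<pi>] A by (simp add: inj_on_image_set_diff)
    then show ?thesis
      using compatible_iso[OF compatible_of_forest forest_isoI[OF iso_via_restrict[OF \<pi> A]]]
        compatible_iso[OF compatible_of_forest forest_isoI[OF iso_via_restrict[OF \<pi>, of "verts f - A"]]]
      by simp
  qed
  then have "forest_coproduct f = (\<Sum>A | descendant_closed f A. ?t g (\<pi> ` A))"
    unfolding forest_coproduct_def by (intro sum.cong) auto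
  also have "\<dots> = forest_coproduct g"
    unfolding forest_coproduct_def by (rule sum.reindex_bij_betw[OF bij])
  finally show "forest_coproduct f = forest_coproduct g" .
next
  fix f :: "'u forest" and v a x b y assume v: "v \<in> verts f"
  let ?l = "\<lambda>x A. of_forest (redecorate (restrict_forest f A) v x)"
  let ?t = "\<lambda>x A. ?l x A \<otimes> ?l x (verts f - A)"
  have c: "forest_coproduct (redecorate f v x) = (\<Sum>A | descendant_closed f A. ?t x A)" for x
    by (simp add: forest_coproduct_def descendant_closed_def restrict_redecorate)
  have out: "?l x A = of_forest (restrict_forest f A)" if "v \<notin> A" for x A
    using that
    by (intro compatible_iso[OF compatible_of_forest] iso_redecorate_outside) (simp add: restrict_forest_simps)
  have ins: "?l (a *\<^sub>R x + b *\<^sub>R y) A = a *\<^sub>R ?l x A + b *\<^sub>R ?l y A" if "v \<in> A" for A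
    using that v by (intro compatible_redecorate[OF compatible_of_forest]) (simp add: restrict_forest_simps)
  have "?t (a *\<^sub>R x + b *\<^sub>R y) A = a *\<^sub>R ?t x A + b *\<^sub>R ?t y A" if "descendant_closed f A" for A
  proof (cases "v \<in> A")
    case True
    then show ?thesis
      by (simp add: ins out bilinear_ladd[OF bilinear_tensor_of] bilinear_lmul[OF bilinear_tensor_of])
  next
    case False
    then show ?thesis
      using v by (simp add: ins out bilinear_radd[OF bilinear_tensor_of] bilinear_rmul[OF bilinear_tensor_of])
  qed
  then show "forest_coproduct (redecorate f v (a *\<^sub>R x + b *\<^sub>R y)) =
      a *\<^sub>R forest_coproduct (redecorate f v x) + b *\<^sub>R forest_coproduct (redecorate f v y)"
    by (simp add: c sum.distrib scaleR_sum_right)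
qed

lemma linear_coproduct: "linear coproduct"
  unfolding coproduct_def by (intro linear_ck_lift compatible_coproduct)

lemma coproduct_of_forest: "coproduct (of_forest f) = forest_coproduct f"
  by (simp add: coproduct_def compatible_coproduct)

lemma bilinear_growth: "bilinear (\<top>)"
  unfolding growth_def by (intro bilinear_ck_lift2 compatible_growth_left compatible_growth_right)

lemma growth_of_forest: "of_forest f \<top> of_forest g = forest_growth f g"
  by (simp add: growth_def ck_lift2_of_forest compatible_growth_left compatible_growth_right)


subsection \<open>The forest algebra\<close>

instantiation ck :: (real_vector) "{comm_ring_1, real_algebra_1}"
begin

definition one_ck :: "'a ck"
  where "1 = of_forest empty_forest"

definition times_ck :: "'a ck \<Rightarrow> 'a ck \<Rightarrow> 'a ck"
  where "(*) = ck_lift2 (\<lambda>f g. of_forest (forest_union f g))"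

instance
proof
  have bil: "bilinear ((*) :: 'a ck \<Rightarrow> _)"
    unfolding times_ck_def by (intro bilinear_ck_lift2 compatible_union_left compatible_union_right)
  have base: "of_forest f * of_forest g = of_forest (forest_union f g)" for f g :: "'a forest"
    by (simp add: times_ck_def ck_lift2_of_forest compatible_union_left compatible_union_right)
  have of_iso: "of_forest f = of_forest g" if "iso_via \<pi> f g" for \<pi> and f g :: "'a forest"
    using compatible_iso[OF compatible_of_forest forest_isoI[OF that]] .
  have linl: "linear (\<lambda>x. x * y)" and linr: "linear (\<lambda>y. x * y)" for x y :: "'a ck"
    using bil by (auto simp: bilinear_def)
  fix a b c :: "'a ck" and r :: real
  show "(a + b) * c = a * c + b * c" by (rule bilinear_ladd[OF bil])
  show "a * (b + c) = a * b + a * c" by (rule bilinear_radd[OF bil])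
  show "r *\<^sub>R a * b = r *\<^sub>R (a * b)" by (rule bilinear_lmul[OF bil])
  show "a * r *\<^sub>R b = r *\<^sub>R (a * b)" by (rule bilinear_rmul[OF bil])
  have comm0: "of_forest f * of_forest g = of_forest g * of_forest f" for f g :: "'a forest"
  proof -
    let ?p = "\<lambda>u :: nat. if even u then Suc u else u - 1"
    have p: "?p (2 * i) = Suc (2 * i)" "?p (Suc (2 * i)) = 2 * i" for i
      by auto
    have "iso_via ?p (forest_union f g) (forest_union g f)"
    proof (rule iso_viaI)
      show "inj_on ?p (verts (forest_union f g))"
        by (rule inj_on_inverseI[of _ ?p]) auto
      show "?p ` verts (forest_union f g) = verts (forest_union g f)"
        unfolding verts_union image_Un image_image p by (simp add: Un_commute)
    next
      fix v assume "v \<in> verts (forest_union f g)"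
      then consider i where "v = 2 * i" | i where "v = Suc (2 * i)"
        by (auto simp: verts_union)
      then have "parent (forest_union g f) (?p v) = map_option ?p (parent (forest_union f g) v) \<and>
          decor (forest_union g f) (?p v) = decor (forest_union f g) v"
        by cases (simp_all only: p parent_union decor_union option.map_comp comp_def simp_thms)
      then show "parent (forest_union g f) (?p v) = map_option ?p (parent (forest_union f g) v)"
        "decor (forest_union g f) (?p v) = decor (forest_union f g) v"
        by simp_all
    qed
    then show ?thesis unfolding base by (rule of_iso)
  qed
  have comm: "a * b = b * a" for a b :: "'a ck"
  proof (rule ck_linear_eqI[OF linl linr])
    fix f :: "'a forest"
    show "of_forest f * b = b * of_forest f"
      by (rule ck_linear_eqI[OF linr linl comm0])
  qed
  show "a * b = b * a" by (rule comm)
  have unit0: "1 * of_forest f = of_forest f" for f :: "'a forest"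
    unfolding base one_ck_def
    by (rule of_iso[of "\<lambda>u. u div 2"], rule iso_viaI)
       (auto simp: verts_union inj_on_def image_image option.map_comp comp_def option.map_ident)
  have unit: "1 * a = a" for a :: "'a ck"
    by (rule ck_linear_eqI[of "\<lambda>a. 1 * a" "\<lambda>a. a", OF linr linear_ident unit0])
  show "1 * a = a" by (rule unit)
  show "a * 1 = a" using unit comm by metis
  have assoc0: "of_forest f * of_forest g * of_forest h = of_forest f * (of_forest g * of_forest h)"
    for f g h :: "'a forest"
  proof -
    let ?p = "\<lambda>u :: nat. if odd u then 2 * u + 1 else if even (u div 2) then u div 2 else u - 1"
    have p: "?p (2 * (2 * i)) = 2 * i" "?p (2 * Suc (2 * i)) = Suc (2 * (2 * i))"
      "?p (Suc (2 * i)) = Suc (2 * Suc (2 * i))" for i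
      by auto
    have "iso_via ?p (forest_union (forest_union f g) h) (forest_union f (forest_union g h))"
    proof (rule iso_viaI)
      show "inj_on ?p (verts (forest_union (forest_union f g) h))"
        by (rule inj_on_inverseI[of _ "\<lambda>u. if even u then 2 * u else if even (u div 2) then u + 1 else u div 2"])
           (auto elim!: evenE oddE)
      show "?p ` verts (forest_union (forest_union f g) h) = verts (forest_union f (forest_union g h))"
        unfolding verts_union image_Un image_image p by (simp add: Un_assoc)
    next
      fix v assume "v \<in> verts (forest_union (forest_union f g) h)"
      then consider i where "v = 2 * (2 * i)" | i where "v = 2 * Suc (2 * i)" | i where "v = Suc (2 * i)"
        by (auto simp: verts_union)
      then have "parent (forest_union f (forest_union g h)) (?p v) =
          map_option ?p (parent (forest_union (forest_union f g) h) v) \<and>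
          decor (forest_union f (forest_union g h)) (?p v) =
          decor (forest_union (forest_union f g) h) v"
        by cases (simp_all only: p parent_union decor_union option.map_comp comp_def simp_thms)
      then show "parent (forest_union f (forest_union g h)) (?p v) =
          map_option ?p (parent (forest_union (forest_union f g) h) v)"
        "decor (forest_union f (forest_union g h)) (?p v) =
          decor (forest_union (forest_union f g) h) v"
        by simp_all
    qed
    then show ?thesis unfolding base by (rule of_iso)
  qed
  show "a * b * c = a * (b * c)"
  proof -
    have 1: "of_forest f * of_forest g * c = of_forest f * (of_forest g * c)" for f g :: "'a forest" and c
      by (rule ck_linear_eqI[of "\<lambda>c. of_forest f * of_forest g * c" "\<lambda>c. of_forest f * (of_forest g * c)"])
         (use assoc0 in \<open>auto intro: linr linear_compose[OF linr linr, unfolded comp_def]\<close>)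
    have 2: "of_forest f * b * c = of_forest f * (b * c)" for f :: "'a forest" and b c
      by (rule ck_linear_eqI[of "\<lambda>b. of_forest f * b * c" "\<lambda>b. of_forest f * (b * c)"])
         (use 1 in \<open>auto intro: linear_compose[OF linr linl, unfolded comp_def] linear_compose[OF linl linr, unfolded comp_def]\<close>)
    show ?thesis
      by (rule ck_linear_eqI[of "\<lambda>a. a * b * c" "\<lambda>a. a * (b * c)"])
         (use 2 in \<open>auto intro: linl linear_compose[OF linl linl, unfolded comp_def]\<close>)
  qed
  show "(0 :: 'a ck) \<noteq> 1"
  proof
    let ?\<epsilon> = "\<lambda>f :: 'a forest. if verts f = {} then 1 else 0 :: real"
    assume "(0 :: 'a ck) = 1"
    moreover have \<epsilon>: "compatible ?\<epsilon>"
      by (rule compatibleI) (auto simp: forest_iso_iff dest: iso_viaD(3))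
    ultimately have "ck_lift ?\<epsilon> (of_forest empty_forest) = ck_lift ?\<epsilon> 0"
      by (simp add: one_ck_def)
    then show False
      using linear_0[OF linear_ck_lift[OF \<epsilon>]] by (simp add: \<epsilon>)
  qed
qed

end

lemma times_of_forest: "of_forest f * of_forest g = of_forest (forest_union f g)"
  by (simp add: times_ck_def ck_lift2_of_forest compatible_union_left compatible_union_right)

lemma growth_one_left [simp]: "1 \<top> z = z"
proof (rule ck_linear_eqI[of "\<lambda>z. 1 \<top> z" "\<lambda>z. z"])
  show "linear (\<lambda>z. 1 \<top> z)"
    using bilinear_growth unfolding bilinear_def by blast
  fix f :: "'a forest"
  show "1 \<top> of_forest f = of_forest f"
    by (simp add: one_ck_def growth_of_forest forest_growth_def)
qed (rule linear_ident)

lemma growth_one_right [simp]: "z \<top> 1 = z"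
proof (rule ck_linear_eqI[of "\<lambda>z. z \<top> 1" "\<lambda>z. z"])
  show "linear (\<lambda>z. z \<top> 1)"
    using bilinear_growth unfolding bilinear_def by blast
  fix f :: "'a forest"
  have "of_forest empty_forest = of_forest f" if "verts f = {}"
  proof (rule compatible_iso[OF compatible_of_forest forest_isoI])
    show "iso_via id empty_forest f"
      by (rule iso_viaI) (simp_all add: that)
  qed
  then show "of_forest f \<top> 1 = of_forest f"
    by (cases "verts f = {}") (simp_all add: one_ck_def growth_of_forest forest_growth_def)
qed (rule linear_ident)


section \<open>Primitive elements and powers for natural growth\<close>

definition primitives :: "'u::real_vector ck set"
  where "primitives = {p. coproduct p = 1 \<otimes> p + p \<otimes> 1}"

primrec growth_power :: "'u::real_vector ck \<Rightarrow> nat \<Rightarrow> 'u ck"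
  where
    "growth_power p 0 = 1"
  | "growth_power p (Suc n) = growth_power p n \<top> p"

lemma growth_power_1: "growth_power p 1 = p"
  by simp

text \<open>The tuples \<open>(a\<^sub>1, \<dots>, a\<^sub>n)\<close> with \<open>a\<^sub>1 + 2 a\<^sub>2 + \<dots> + n a\<^sub>n = n\<close>, extended by \<open>0\<close> to functions on
  the natural numbers.\<close>

definition weight_tuples :: "nat \<Rightarrow> (nat \<Rightarrow> nat) set"
  where "weight_tuples n = {a. (\<forall>k. k \<notin> {1..n} \<longrightarrow> a k = 0) \<and> (\<Sum>k=1..n. k * a k) = n}"

lemma finite_weight_tuples: "finite (weight_tuples n)"
proof (rule finite_subset)
  show "weight_tuples n \<subseteq> {a. \<forall>k. (k \<in> {1..n} \<longrightarrow> a k \<in> {..n}) \<and> (k \<notin> {1..n} \<longrightarrow> a k = 0)}"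
  proof (rule subsetI, rule CollectI, intro allI conjI impI)
    fix a k assume a: "a \<in> weight_tuples n" and k: "k \<in> {1..n}"
    have "a k \<le> k * a k" using k by simp
    also have "\<dots> \<le> (\<Sum>k=1..n. k * a k)"
      using k by (intro member_le_sum) auto
    finally show "a k \<in> {..n}" using a by (simp add: weight_tuples_def)
  qed (simp add: weight_tuples_def)
  show "finite {a. \<forall>k. (k \<in> {1..n} \<longrightarrow> a k \<in> {..n}) \<and> (k \<notin> {1..n} \<longrightarrow> a k = 0)}"
    by (rule finite_set_of_finite_funs) auto
qed

text \<open>The element \<open>P\<^sub>n\<close> attached to \<open>p\<close>.  For \<open>n \<ge> 1\<close> the sum of a weight tuple is positive, so the
  truncated subtraction is harmless.\<close>

definition growth_log :: "'u::real_vector ck \<Rightarrow> nat \<Rightarrow> 'u ck"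
  where "growth_log p n = (\<Sum>a\<in>weight_tuples n.
    ((-1) ^ ((\<Sum>k=1..n. a k) - 1) * fact ((\<Sum>k=1..n. a k) - 1) / (\<Prod>k=1..n. fact (a k)) :: real)
      *\<^sub>R (\<Prod>k=1..n. growth_power p k ^ a k))"


section \<open>Branched rough paths\<close>

definition ck_upto :: "enat \<Rightarrow> 'u::real_vector ck set"
  where "ck_upto N = span {of_forest f | f. enat (nverts f) \<le> N}"

definition control :: "real \<Rightarrow> (real \<Rightarrow> real \<Rightarrow> real) \<Rightarrow> bool"
  where "control T \<omega> \<longleftrightarrow>
    continuous_on {(s, t). 0 \<le> s \<and> s \<le> t \<and> t \<le> T} (\<lambda>(s, t). \<omega> s t) \<and>
    (\<forall>s t. 0 \<le> s \<and> s \<le> t \<and> t \<le> T \<longrightarrow> 0 \<le> \<omega> s t) \<and>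
    (\<forall>s u t. 0 \<le> s \<and> s \<le> u \<and> u \<le> t \<and> t \<le> T \<longrightarrow> \<omega> s u + \<omega> u t \<le> \<omega> s t)"

text \<open>
  The conditions on a branched rough path in weights \<open>\<le> N\<close>.  A linear functional on \<open>ck_upto N\<close> is
  represented by an arbitrary linear functional on the whole space extending it; every condition
  below involves its values on \<open>ck_upto N\<close> only.  The estimate is trivial for the empty forest, which
  is left out because of the convention \<open>0 powr 0 = 0\<close>.
\<close>

definition branched_upto ::
    "enat \<Rightarrow> real \<Rightarrow> (real \<Rightarrow> real \<Rightarrow> real) \<Rightarrow> real \<Rightarrow> (real \<Rightarrow> real \<Rightarrow> 'u::real_vector ck \<Rightarrow> real) \<Rightarrow> bool"
  where "branched_upto N \<rho> \<omega> T X \<longleftrightarrow>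
    (\<forall>s t. 0 \<le> s \<and> s \<le> t \<and> t \<le> T \<longrightarrow>
      linear (X s t) \<and> X s t 1 = 1 \<and>
      (\<forall>f g. enat (nverts f + nverts g) \<le> N \<longrightarrow>
        X s t (of_forest f * of_forest g) = X s t (of_forest f) * X s t (of_forest g))) \<and>
    (\<forall>s u t. 0 \<le> s \<and> s \<le> u \<and> u \<le> t \<and> t \<le> T \<longrightarrow>
      (\<forall>h\<in>ck_upto N. X s t h = tensor_eval (X s u) (X u t) (coproduct h))) \<and>
    (\<forall>f. verts f \<noteq> {} \<and> enat (nverts f) \<le> N \<longrightarrow>
      (\<exists>C. \<forall>s t. 0 \<le> s \<and> s \<le> t \<and> t \<le> T \<longrightarrow>
        \<bar>X s t (of_forest f)\<bar> \<le> C * \<omega> s t powr (real (nverts f) / \<rho>)))"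

definition branched_rough_path ::
    "real \<Rightarrow> (real \<Rightarrow> real \<Rightarrow> real) \<Rightarrow> real \<Rightarrow>
      (real \<Rightarrow> real \<Rightarrow> ('v::real_normed_vector \<Rightarrow>\<^sub>L real) ck \<Rightarrow> real) \<Rightarrow> bool"
  where "branched_rough_path \<rho> \<omega> T X \<longleftrightarrow>
    1 \<le> \<rho> \<and> 0 \<le> T \<and> control T \<omega> \<and> branched_upto (enat (nat \<lfloor>\<rho>\<rfloor>)) \<rho> \<omega> T X"

definition is_signature ::
    "real \<Rightarrow> (real \<Rightarrow> real \<Rightarrow> real) \<Rightarrow> real \<Rightarrow>
      (real \<Rightarrow> real \<Rightarrow> ('v::real_normed_vector \<Rightarrow>\<^sub>L real) ck \<Rightarrow> real) \<Rightarrow>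
      (real \<Rightarrow> real \<Rightarrow> ('v \<Rightarrow>\<^sub>L real) ck \<Rightarrow> real) \<Rightarrow> bool"
  where "is_signature \<rho> \<omega> T X S \<longleftrightarrow>
    branched_upto \<infinity> \<rho> \<omega> T S \<and>
    (\<forall>s t. 0 \<le> s \<and> s \<le> t \<and> t \<le> T \<longrightarrow> (\<forall>h\<in>ck_upto (enat (nat \<lfloor>\<rho>\<rfloor>)). S s t h = X s t h))"

end

theory Submission
  imports Defs
begin

text \<open>
  Let \<open>G = 1 + p t + p\<^bsup>\<top>2\<^esup> t\<^sup>2 + \<dots>\<close> be the generating series of the powers of \<open>p\<close> for natural growth.  The
  sum over weight tuples defining \<open>P\<^sub>n\<close> is the coefficient of \<open>t\<^sup>n\<close> in \<open>log G\<close>, and the sum over weight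
  tuples to be matched with \<open>p\<^bsup>\<top>n\<^esup>\<close> is the coefficient of \<open>t\<^sup>n\<close> in \<open>exp (log G)\<close>.  The first identity is
  therefore a formal fact about any sequence \<open>g\<close> with \<open>g 0 = 1\<close> in a commutative real algebra
  (\<open>exp_sum_log_sum\<close>).  It is proved by the differential equation \<open>D G = D (log G) * G\<close> for
  \<open>D = t d/dt\<close>, which in coefficients reads \<open>n g\<^sub>n = \<Sum>k. k P\<^sub>k g\<^bsub>n-k\<^esub>\<close> (\<open>log_sum_recursion\<close>) and which
  determines the sequence.

  The algebraic content is that \<open>G\<close> is group-like, \<open>\<Delta> p\<^bsup>\<top>n\<^esup> = \<Sum>i. p\<^bsup>\<top>i\<^esup> \<otimes> p\<^bsup>\<top>(n-i)\<^esup>\<close>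
  (\<open>coproduct_growth_power\<close>).  It follows by induction from the cocycle property
  \<open>\<Delta> (z \<top> p) = (z \<top> p) \<otimes> 1 + (id \<otimes> (\<cdot> \<top> p)) \<Delta> z\<close> for primitive \<open>p\<close> (\<open>coproduct_growth_primitive\<close>).
  For the latter, cut the grafting of a forest \<open>f\<close> onto a vertex \<open>v\<close> of a forest \<open>g\<close>: a descendant-closed
  set either contains \<open>v\<close>, and then all of \<open>f\<close>, or it is a pair of descendant-closed sets of \<open>f\<close> and of \<open>g\<close>,
  the latter without \<open>v\<close>.  Summed over \<open>v\<close> this expresses the coproduct of the sum of all graftings
  bilinearly through the cuts of \<open>g\<close> (\<open>coproduct_growth_forest\<close>), and for primitive elements
  only the two trivial cuts contribute.  The division by the number of vertices in \<open>\<top>\<close> is absorbed beforehand: the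
  coproduct respects the grading, so \<open>p\<close> divided by its degree is again primitive
  (\<open>primitive_eq_nverts_scale\<close>).

  As the coproduct is multiplicative, the logarithm of a group-like series has primitive coefficients
  (\<open>log_sum_primitive\<close>).  Finally, a signature is a character of the forest algebra at each pair of times,
  so it can be applied to the identity, and the Chen identity on the primitive element \<open>P\<^sub>k\<close>
  is additivity.
\<close>

section \<open>Sums over weight tuples as coefficients of power series\<close>

text \<open>
  For \<open>X = x\<^sub>1 t + x\<^sub>2 t\<^sup>2 + \<dots>\<close> the multinomial theorem makes \<open>weight_sum c x n\<close> the coefficient of
  \<open>t\<^sup>n\<close> in \<open>F(X) = \<Sum>m. c m / m! * X\<^sup>m\<close>.  Shifting \<open>c\<close> by one replaces \<open>F\<close> by its derivative.  The
  choices \<open>1\<close>, \<open>(-1)\<^sup>m m!\<close> and \<open>(-1)\<^bsup>m-1\<^esup> (m-1)!\<close> (for \<open>m \<ge> 1\<close>) of \<open>c m\<close> give \<open>exp X\<close>, \<open>1 / (1 + X)\<close> and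
  \<open>log (1 + X)\<close>.
\<close>

definition weight_sum :: "(nat \<Rightarrow> real) \<Rightarrow> (nat \<Rightarrow> 'a::{comm_ring_1,real_algebra_1}) \<Rightarrow> nat \<Rightarrow> 'a"
  where "weight_sum c x n = (\<Sum>a\<in>weight_tuples n.
    (c (\<Sum>k=1..n. a k) / (\<Prod>k=1..n. fact (a k))) *\<^sub>R (\<Prod>k=1..n. x k ^ a k))"

lemma weight_tuples_0: "weight_tuples 0 = {\<lambda>_. 0}"
  by (auto simp: weight_tuples_def)

lemma weight_sum_0 [simp]: "weight_sum c x 0 = c 0 *\<^sub>R 1"
  by (simp add: weight_sum_def weight_tuples_0)

lemma weight_tuples_raise:
  assumes "k \<in> {1..n}"
  shows "bij_betw (\<lambda>b. b(k := Suc (b k))) (weight_tuples (n - k)) {a \<in> weight_tuples n. a k \<noteq> 0}"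
proof (rule bij_betw_byWitness[where f' = "\<lambda>a. a(k := a k - 1)"])
  have split: "(\<Sum>j=1..n. j * a j) = k * a k + (\<Sum>j\<in>{1..n}-{k}. j * a j)" for a
    using assms by (simp add: sum.remove)
  show "(\<lambda>b. b(k := Suc (b k))) ` weight_tuples (n - k) \<subseteq> {a \<in> weight_tuples n. a k \<noteq> 0}"
  proof (rule image_subsetI)
    fix b assume b: "b \<in> weight_tuples (n - k)"
    have "(\<Sum>j=1..n-k. j * b j) = (\<Sum>j=1..n. j * b j)"
      using b by (intro sum.mono_neutral_left) (auto simp: weight_tuples_def)
    then have "(\<Sum>j=1..n. j * b j) = n - k"
      using b by (simp add: weight_tuples_def)
    then have "k * b k + (\<Sum>j\<in>{1..n}-{k}. j * b j) = n - k"
      unfolding split .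
    moreover have "(\<Sum>j\<in>{1..n}-{k}. j * (b(k := Suc (b k))) j) = (\<Sum>j\<in>{1..n}-{k}. j * b j)"
      by (intro sum.cong) auto
    moreover have "k \<le> n" using assms by simp
    ultimately have "(\<Sum>j=1..n. j * (b(k := Suc (b k))) j) = n"
      unfolding split by (simp only: fun_upd_same mult_Suc_right)
    moreover have "j \<notin> {1..n} \<longrightarrow> (b(k := Suc (b k))) j = 0" for j
      using b assms by (auto simp: weight_tuples_def)
    ultimately show "b(k := Suc (b k)) \<in> {a \<in> weight_tuples n. a k \<noteq> 0}"
      by (simp add: weight_tuples_def)
  qed
  show "(\<lambda>a. a(k := a k - 1)) ` {a \<in> weight_tuples n. a k \<noteq> 0} \<subseteq> weight_tuples (n - k)"
  proof (rule image_subsetI)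
    fix a assume a: "a \<in> {a \<in> weight_tuples n. a k \<noteq> 0}"
    define b where "b = a(k := a k - 1)"
    have "(\<Sum>j=1..n. j * a j) = n" "a k \<noteq> 0"
      using a by (auto simp: weight_tuples_def)
    moreover have "k * a k = k * b k + k"
      using \<open>a k \<noteq> 0\<close> by (cases "a k") (auto simp: b_def)
    moreover have "(\<Sum>j\<in>{1..n}-{k}. j * a j) = (\<Sum>j\<in>{1..n}-{k}. j * b j)"
      by (intro sum.cong) (auto simp: b_def)
    ultimately have total: "(\<Sum>j=1..n. j * b j) = n - k"
      unfolding split by simp
    have small: "b j = 0" if "j \<notin> {1..n-k}" for j
    proof (cases "j \<in> {1..n}")
      case True
      then have "j * b j \<le> n - k"
        using member_le_sum[of j "{1..n}" "\<lambda>j. j * b j"] unfolding total by simp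
      moreover have "j > n - k" using that True by auto
      ultimately show ?thesis by (cases "b j") auto
    next
      case False
      then show ?thesis using a assms by (auto simp: weight_tuples_def b_def)
    qed
    have "(\<Sum>j=1..n-k. j * b j) = (\<Sum>j=1..n. j * b j)"
      by (intro sum.mono_neutral_left) (auto intro: small)
    then show "b \<in> weight_tuples (n - k)"
      using total small by (simp add: weight_tuples_def)
  qed
qed auto

text \<open>
  Removing one marked copy of \<open>k\<close> from a tuple lowers its weight by \<open>k\<close> and its length by one; the
  factor \<open>a k\<close> turns \<open>1 / (a k)!\<close> into \<open>1 / (a k - 1)!\<close>.
\<close>

lemma weight_sum_marked_part:
  fixes x :: "nat \<Rightarrow> 'a::{comm_ring_1,real_algebra_1}"
  assumes "k \<in> {1..n}"
  shows "(\<Sum>a\<in>weight_tuples n. (real (a k) * c (\<Sum>j=1..n. a j) / (\<Prod>j=1..n. fact (a j))) *\<^sub>R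
      (\<Prod>j=1..n. x j ^ a j)) = x k * weight_sum (\<lambda>m. c (Suc m)) x (n - k)"
    (is "(\<Sum>a\<in>_. ?T a) = _")
proof -
  have "(\<Sum>a\<in>weight_tuples n. ?T a) = (\<Sum>a | a \<in> weight_tuples n \<and> a k \<noteq> 0. ?T a)"
    by (intro sum.mono_neutral_right finite_weight_tuples) auto
  also have "\<dots> = (\<Sum>b\<in>weight_tuples (n - k). ?T (b(k := Suc (b k))))"
    by (rule sum.reindex_bij_betw[OF weight_tuples_raise[OF assms], symmetric])
  also have "\<dots> = (\<Sum>b\<in>weight_tuples (n - k). x k *
      ((c (Suc (\<Sum>j=1..n-k. b j)) / (\<Prod>j=1..n-k. fact (b j))) *\<^sub>R (\<Prod>j=1..n-k. x j ^ b j)))"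
  proof (intro sum.cong refl)
    fix b assume b: "b \<in> weight_tuples (n - k)"
    have zero: "b j = 0" if "j \<in> {1..n} - {1..n-k}" for j
      using b that by (simp add: weight_tuples_def)
    have k: "finite {1..n}" "k \<in> {1..n}" using assms by auto
    have 1: "(\<Sum>j=1..n. (b(k := Suc (b k))) j) = Suc (\<Sum>j=1..n-k. b j)"
    proof -
      have "(\<Sum>j=1..n-k. b j) = (\<Sum>j=1..n. b j)"
        using zero by (intro sum.mono_neutral_left) auto
      moreover have "(\<Sum>j\<in>{1..n}-{k}. (b(k := Suc (b k))) j) = (\<Sum>j\<in>{1..n}-{k}. b j)"
        by (intro sum.cong) auto
      ultimately show ?thesis by (simp only: sum.remove[OF k]) simp
    qed
    have 2: "(\<Prod>j=1..n. fact ((b(k := Suc (b k))) j)) = real (Suc (b k)) * (\<Prod>j=1..n-k. fact (b j))"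
    proof -
      have "(\<Prod>j=1..n-k. fact (b j)) = (\<Prod>j=1..n. fact (b j) :: real)"
        using zero by (intro prod.mono_neutral_left) auto
      moreover have "(\<Prod>j\<in>{1..n}-{k}. fact ((b(k := Suc (b k))) j)) = (\<Prod>j\<in>{1..n}-{k}. fact (b j) :: real)"
        by (intro prod.cong) auto
      ultimately show ?thesis by (simp only: prod.remove[OF k]) (simp add: mult.assoc)
    qed
    have 3: "(\<Prod>j=1..n. x j ^ (b(k := Suc (b k))) j) = x k * (\<Prod>j=1..n-k. x j ^ b j)"
    proof -
      have "(\<Prod>j=1..n-k. x j ^ b j) = (\<Prod>j=1..n. x j ^ b j)"
        using zero by (intro prod.mono_neutral_left) auto
      moreover have "(\<Prod>j\<in>{1..n}-{k}. x j ^ (b(k := Suc (b k))) j) = (\<Prod>j\<in>{1..n}-{k}. x j ^ b j)"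
        by (intro prod.cong) auto
      ultimately show ?thesis by (simp only: prod.remove[OF k]) (simp add: mult.assoc)
    qed
    show "?T (b(k := Suc (b k))) = x k *
        ((c (Suc (\<Sum>j=1..n-k. b j)) / (\<Prod>j=1..n-k. fact (b j))) *\<^sub>R (\<Prod>j=1..n-k. x j ^ b j))"
      unfolding 1 2 3 by simp
  qed
  finally show ?thesis
    by (simp add: weight_sum_def sum_distrib_left)
qed

text \<open>
  The chain rule for the derivation that multiplies \<open>x k\<close> by \<open>w k\<close>.  It acts on a monomial of exponents
  \<open>a\<close> as \<open>\<Sum>k. w k * a k\<close>.  The choice \<open>w k = k\<close> is \<open>t d/dt\<close>, and \<open>w k = 1\<close> is the Euler operator
  \<open>X d/dX\<close>; these two cases yield all the recursions below.
\<close>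

lemma weight_sum_derivation:
  fixes x :: "nat \<Rightarrow> 'a::{comm_ring_1,real_algebra_1}"
  shows "(\<Sum>a\<in>weight_tuples n. ((\<Sum>k=1..n. w k * real (a k)) * c (\<Sum>k=1..n. a k) /
      (\<Prod>k=1..n. fact (a k))) *\<^sub>R (\<Prod>k=1..n. x k ^ a k)) =
    (\<Sum>k=1..n. w k *\<^sub>R (x k * weight_sum (\<lambda>m. c (Suc m)) x (n - k)))"
proof -
  have "(\<Sum>k=1..n. w k *\<^sub>R (x k * weight_sum (\<lambda>m. c (Suc m)) x (n - k))) =
      (\<Sum>k=1..n. \<Sum>a\<in>weight_tuples n. (w k * real (a k) * (c (\<Sum>k=1..n. a k) /
        (\<Prod>k=1..n. fact (a k)))) *\<^sub>R (\<Prod>k=1..n. x k ^ a k))"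
    by (intro sum.cong refl)
       (simp add: weight_sum_marked_part[symmetric] scaleR_sum_right mult.assoc)
  also have "\<dots> = (\<Sum>a\<in>weight_tuples n. ((\<Sum>k=1..n. w k * real (a k)) * c (\<Sum>k=1..n. a k) /
      (\<Prod>k=1..n. fact (a k))) *\<^sub>R (\<Prod>k=1..n. x k ^ a k))"
    by (subst sum.swap)
       (simp only: scaleR_sum_left[symmetric] sum_distrib_right[symmetric]
          sum_divide_distrib[symmetric] times_divide_eq_right)
  finally show ?thesis ..
qed

lemma weight_sum_by_weight:
  "real n *\<^sub>R weight_sum c x n = (\<Sum>k=1..n. real k *\<^sub>R (x k * weight_sum (\<lambda>m. c (Suc m)) x (n - k)))"
proof -
  have "real n = (\<Sum>k=1..n. real k * real (a k))" if "a \<in> weight_tuples n" for a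
    using that by (auto simp: weight_tuples_def simp flip: of_nat_mult of_nat_sum)
  then have "real n *\<^sub>R weight_sum c x n = (\<Sum>a\<in>weight_tuples n. ((\<Sum>k=1..n. real k * real (a k)) *
      c (\<Sum>k=1..n. a k) / (\<Prod>k=1..n. fact (a k))) *\<^sub>R (\<Prod>k=1..n. x k ^ a k))"
    unfolding weight_sum_def scaleR_sum_right by (intro sum.cong refl) simp
  then show ?thesis
    unfolding weight_sum_derivation .
qed

lemma weight_sum_by_length:
  "weight_sum (\<lambda>m. real m * c m) x n = (\<Sum>k=1..n. x k * weight_sum (\<lambda>m. c (Suc m)) x (n - k))"
proof -
  have "weight_sum (\<lambda>m. real m * c m) x n = (\<Sum>a\<in>weight_tuples n. ((\<Sum>k=1..n. 1 * real (a k)) *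
      c (\<Sum>k=1..n. a k) / (\<Prod>k=1..n. fact (a k))) *\<^sub>R (\<Prod>k=1..n. x k ^ a k))"
    by (simp add: weight_sum_def)
  then show ?thesis
    by (simp only: weight_sum_derivation[where w = "\<lambda>_. 1"] scaleR_one)
qed

text \<open>
  At \<open>n = 0\<close> the truncated subtraction makes the value \<open>1\<close> instead of the constant term \<open>0\<close> of the
  logarithm; \<open>t d/dt\<close> annihilates constant terms, so the recursions hold with this value.
\<close>

abbreviation log_sum :: "(nat \<Rightarrow> 'a::{comm_ring_1,real_algebra_1}) \<Rightarrow> nat \<Rightarrow> 'a"
  where "log_sum \<equiv> weight_sum (\<lambda>m. (-1) ^ (m - 1) * fact (m - 1))"

abbreviation exp_sum :: "(nat \<Rightarrow> 'a::{comm_ring_1,real_algebra_1}) \<Rightarrow> nat \<Rightarrow> 'a"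
  where "exp_sum \<equiv> weight_sum (\<lambda>_. 1)"

text \<open>
  The identity \<open>(1 + X) * (1 / (1 + X)) = 1\<close> in degree \<open>n\<close>.  It is an instance of the Euler operator
  because \<open>(-1)\<^sup>m m! = m * ((-1)\<^sup>m (m-1)!)\<close> for \<open>m \<ge> 1\<close>, and \<open>(-1)\<^sup>m (m-1)!\<close> shifts to
  \<open>- (-1)\<^sup>m m!\<close>.
\<close>

lemma weight_sum_geometric_recursion:
  assumes "n \<ge> 1"
  shows "weight_sum (\<lambda>m. (-1) ^ m * fact m) x n =
    - (\<Sum>k=1..n. x k * weight_sum (\<lambda>m. (-1) ^ m * fact m) x (n - k))"
proof -
  let ?d = "\<lambda>m. (-1) ^ m * fact (m - 1) :: real"
  \<comment> \<open>For \<open>n \<ge> 1\<close> no tuple is zero, so the value of \<open>?d\<close> at \<open>0\<close> does not occur.\<close>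
  have "weight_sum (\<lambda>m. (-1) ^ m * fact m) x n = weight_sum (\<lambda>m. real m * ?d m) x n"
    unfolding weight_sum_def
  proof (intro sum.cong refl arg_cong2[of _ _ _ _ scaleR] arg_cong2[of _ _ _ _ divide])
    fix a assume a: "a \<in> weight_tuples n"
    have "(\<Sum>k=1..n. a k) \<noteq> 0"
    proof
      assume "(\<Sum>k=1..n. a k) = 0"
      then have "(\<Sum>k=1..n. k * a k) = 0" by simp
      then show False using a assms by (simp add: weight_tuples_def)
    qed
    then show "(-1) ^ (\<Sum>k=1..n. a k) * fact (\<Sum>k=1..n. a k) = real (\<Sum>k=1..n. a k) * ?d (\<Sum>k=1..n. a k)"
      by (cases "\<Sum>k=1..n. a k") simp_all
  qed
  also have "\<dots> = (\<Sum>k=1..n. x k * weight_sum (\<lambda>m. - ((-1) ^ m * fact m)) x (n - k))"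
    unfolding weight_sum_by_length by simp
  also have "\<dots> = - (\<Sum>k=1..n. x k * weight_sum (\<lambda>m. (-1) ^ m * fact m) x (n - k))"
    by (simp add: weight_sum_def sum_negf)
  finally show ?thesis .
qed

text \<open>
  With \<open>L = log (1 + X)\<close> and \<open>D = t d/dt\<close>, the chain rule gives \<open>D L = D X / (1 + X)\<close>; multiplied by
  \<open>1 + X\<close> this is \<open>D (1 + X) = D L * (1 + X)\<close>, whose coefficients are the two sides.
\<close>

lemma log_sum_recursion:
  fixes x :: "nat \<Rightarrow> 'a::{comm_ring_1,real_algebra_1}"
  assumes "x 0 = 1"
  shows "real n *\<^sub>R x n = (\<Sum>k=1..n. real k *\<^sub>R (log_sum x k * x (n - k)))"
proof -
  let ?h = "weight_sum (\<lambda>m. (-1) ^ m * fact m) x"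
  define X where "X = Abs_fps x"
  define H where "H = Abs_fps ?h"
  define X' where "X' = Abs_fps (\<lambda>n. real n *\<^sub>R x n)"
  define L' where "L' = Abs_fps (\<lambda>n. real n *\<^sub>R log_sum x n)"
  have from_1: "(\<Sum>k=0..n. u k) = u 0 + (\<Sum>k=1..n. u k)" for u :: "nat \<Rightarrow> 'a" and n
    by (simp add: sum.atLeast_Suc_atMost)
  have "fps_nth (X * H) n = fps_nth 1 n" for n
  proof (cases "n = 0")
    case False
    then show ?thesis
      using weight_sum_geometric_recursion[of n x] assms
      by (simp add: fps_mult_nth from_1 X_def H_def)
  qed (simp add: X_def H_def assms)
  then have inverse: "X * H = 1" by (simp add: fps_eq_iff)
  have "fps_nth L' n = fps_nth (X' * H) n" for n
    by (simp add: L'_def X'_def H_def fps_mult_nth from_1 weight_sum_by_weight)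
  then have "L' = X' * H" by (simp add: fps_eq_iff)
  then have "X' = L' * X"
    using inverse by (simp add: mult.assoc mult.commute[of H])
  then have "fps_nth X' n = fps_nth (L' * X) n" by simp
  then show ?thesis
    by (simp add: X'_def L'_def X_def fps_mult_nth from_1)
qed

text \<open>
  The coefficients of \<open>exp L\<close> and those of \<open>1 + X\<close> both solve the recursion of the preceding lemma,
  which determines them from the constant term.
\<close>

lemma exp_sum_log_sum:
  fixes x :: "nat \<Rightarrow> 'a::{comm_ring_1,real_algebra_1}"
  assumes "x 0 = 1"
  shows "exp_sum (log_sum x) n = x n"
proof (induction n rule: less_induct)
  case (less n)
  show ?case
  proof (cases "n = 0")
    case False
    have "real n *\<^sub>R exp_sum (log_sum x) n =
        (\<Sum>k=1..n. real k *\<^sub>R (log_sum x k * exp_sum (log_sum x) (n - k)))"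
      by (rule weight_sum_by_weight)
    also have "\<dots> = (\<Sum>k=1..n. real k *\<^sub>R (log_sum x k * x (n - k)))"
      using less by (intro sum.cong refl) auto
    also have "\<dots> = real n *\<^sub>R x n"
      by (rule log_sum_recursion[of x, OF assms, symmetric])
    finally show ?thesis using False by simp
  qed (simp add: assms)
qed

lemma prod_scaleR:
  fixes x :: "'i \<Rightarrow> 'a::{comm_ring_1,real_algebra_1}"
  shows "(\<Prod>k\<in>A. c k *\<^sub>R x k) = (\<Prod>k\<in>A. c k) *\<^sub>R (\<Prod>k\<in>A. x k)"
  by (induction A rule: infinite_finite_induct) (simp_all add: mult.commute)

lemma exp_sum_eq: "exp_sum x n = (\<Sum>a\<in>weight_tuples n. \<Prod>k=1..n. (1 / fact (a k) :: real) *\<^sub>R x k ^ a k)"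
  by (simp add: weight_sum_def prod_scaleR prod_dividef)

section \<open>Bilinear maps on the forest algebra\<close>

lemmas tensor_of_simps =
  bilinear_ladd[OF bilinear_tensor_of] bilinear_radd[OF bilinear_tensor_of]
  bilinear_lmul[OF bilinear_tensor_of] bilinear_rmul[OF bilinear_tensor_of]
  bilinear_lzero[OF bilinear_tensor_of] bilinear_rzero[OF bilinear_tensor_of]

lemmas growth_simps =
  bilinear_ladd[OF bilinear_growth] bilinear_radd[OF bilinear_growth]
  bilinear_lmul[OF bilinear_growth] bilinear_rmul[OF bilinear_growth]
  bilinear_rzero[OF bilinear_growth]

lemma tensor_of_sum_left: "(\<Sum>i\<in>I. x i) \<otimes> y = (\<Sum>i\<in>I. x i \<otimes> y)"
  by (rule linear_sum[where f = "\<lambda>x. x \<otimes> y"], rule linearI) (simp_all add: tensor_of_simps)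

lemma tensor_of_sum_right: "x \<otimes> (\<Sum>i\<in>I. y i) = (\<Sum>i\<in>I. x \<otimes> y i)"
  by (rule linear_sum[where f = "\<lambda>y. x \<otimes> y"], rule linearI) (simp_all add: tensor_of_simps)

lemma bilinearI:
  assumes "\<And>x x' y. \<beta> (x + x') y = \<beta> x y + \<beta> x' y" "\<And>c x y. \<beta> (c *\<^sub>R x) y = c *\<^sub>R \<beta> x y"
    "\<And>x y y'. \<beta> x (y + y') = \<beta> x y + \<beta> x y'" "\<And>c x y. \<beta> x (c *\<^sub>R y) = c *\<^sub>R \<beta> x y"
  shows "bilinear \<beta>"
  unfolding bilinear_def by (auto intro: linearI assms)

lemma tensor_lift_add_map: "tensor_lift (\<lambda>x y. \<beta> x y + \<gamma> x y) w = tensor_lift \<beta> w + tensor_lift \<gamma> w"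
  unfolding tensor_lift_def lin_ext_def
  by (simp add: case_prod_unfold scaleR_add_right sum.distrib)

lemma tensor_lift_scale_map: "tensor_lift (\<lambda>x y. c *\<^sub>R \<beta> x y) w = c *\<^sub>R tensor_lift \<beta> w"
  unfolding tensor_lift_def lin_ext_def
  by (simp add: case_prod_unfold scaleR_sum_right mult.commute)

lemma tensor_lift_sum:
  assumes "bilinear \<beta>"
  shows "tensor_lift \<beta> (\<Sum>i\<in>I. x i \<otimes> y i) = (\<Sum>i\<in>I. \<beta> (x i) (y i))"
  by (simp add: linear_sum[OF linear_tensor_lift[OF assms]] assms)

lemma ck_linear_eqI': "linear F \<Longrightarrow> linear G \<Longrightarrow> (\<And>f. F (of_forest f) = G (of_forest f)) \<Longrightarrow> F = G"
  using ck_linear_eqI by blast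

lemma of_forest_iso: "iso_via \<pi> f g \<Longrightarrow> of_forest f = of_forest g"
  by (rule compatible_iso[OF compatible_of_forest forest_isoI])

lemma of_forest_no_verts: "verts f = {} \<Longrightarrow> of_forest f = 1"
  unfolding one_ck_def by (rule of_forest_iso[of "\<lambda>v. v"], rule iso_viaI) auto

section \<open>The coproduct of a product\<close>

text \<open>
  The vertex set of a disjoint union, and of a grafting, consists of doubled and of doubled-plus-one
  numbers; its subsets are parametrised by pairs of subsets of the two vertex sets.
\<close>

definition union_subset :: "nat set \<Rightarrow> nat set \<Rightarrow> nat set"
  where "union_subset A B = (\<lambda>i. 2 * i) ` A \<union> (\<lambda>i. Suc (2 * i)) ` B"

lemma in_union_subset [simp]:
  "2 * i \<in> union_subset A B \<longleftrightarrow> i \<in> A" "Suc (2 * i) \<in> union_subset A B \<longleftrightarrow> i \<in> B"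
  by (auto simp: union_subset_def)

lemma even_odd_cases:
  obtains i where "u = 2 * i" | i where "u = Suc (2 * i)"
  by (metis evenE oddE Suc_eq_plus1)

lemma set_eq_even_odd:
  "S = T \<longleftrightarrow> (\<forall>i. 2 * i \<in> S \<longleftrightarrow> 2 * i \<in> T) \<and> (\<forall>i. Suc (2 * i) \<in> S \<longleftrightarrow> Suc (2 * i) \<in> T)"
  by (metis even_odd_cases subsetI subset_antisym)

lemma subset_even_odd:
  "S \<subseteq> T \<longleftrightarrow> (\<forall>i. 2 * i \<in> S \<longrightarrow> 2 * i \<in> T) \<and> (\<forall>i. Suc (2 * i) \<in> S \<longrightarrow> Suc (2 * i) \<in> T)"
  by (metis even_odd_cases subset_iff)

lemma verts_union_subset: "verts (forest_union f g) = union_subset (verts f) (verts g)"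
  by (simp add: verts_union union_subset_def)

lemma union_subset_Diff: "union_subset A B - union_subset A' B' = union_subset (A - A') (B - B')"
  by (simp add: set_eq_even_odd)

lemma union_subset_mono: "union_subset A B \<subseteq> union_subset A' B' \<longleftrightarrow> A \<subseteq> A' \<and> B \<subseteq> B'"
  unfolding subset_even_odd[of "union_subset A B"] by (simp add: subset_iff)

lemma sum_union_subsets:
  assumes P: "\<And>A B. P (union_subset A B) \<longleftrightarrow> B \<in> J \<and> A \<in> I B"
    and fin: "finite J" "\<And>B. B \<in> J \<Longrightarrow> finite (I B)"
  shows "(\<Sum>S | P S. h S) = (\<Sum>B\<in>J. \<Sum>A\<in>I B. h (union_subset A B))"
proof -
  let ?p = "\<lambda>(B, A). union_subset A B"
  have "bij ?p"
    by (rule bij_betw_byWitness[where f' = "\<lambda>S. ({i. Suc (2 * i) \<in> S}, {i. 2 * i \<in> S})"])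
       (auto simp: set_eq_even_odd)
  then have "bij_betw ?p {x \<in> UNIV. x \<in> Sigma J I} {S \<in> UNIV. P S}"
    by (rule bij_betw_Collect) (auto simp: P)
  then have "bij_betw ?p (Sigma J I) {S. P S}" by simp
  from sum.reindex_bij_betw[OF this, of h, symmetric]
  show ?thesis
    using fin by (simp add: sum.Sigma case_prod_unfold)
qed

lemma restrict_union:
  "restrict_forest (forest_union f g) (union_subset A B) =
    forest_union (restrict_forest f A) (restrict_forest g B)"
proof (rule forest_eqI)
  let ?S = "union_subset A B"
  show "verts (restrict_forest (forest_union f g) ?S) =
      verts (forest_union (restrict_forest f A) (restrict_forest g B))"
    by (auto simp: restrict_forest_simps verts_union)
  show "decor (restrict_forest (forest_union f g) ?S) =
      decor (forest_union (restrict_forest f A) (restrict_forest g B))"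
    by (simp add: restrict_forest_simps forest_union_simps cong: if_cong)
  show "parent (restrict_forest (forest_union f g) ?S) =
      parent (forest_union (restrict_forest f A) (restrict_forest g B))"
  proof
    fix u
    show "parent (restrict_forest (forest_union f g) ?S) u =
        parent (forest_union (restrict_forest f A) (restrict_forest g B)) u"
      by (cases u rule: even_odd_cases) (simp_all only: restrict_forest_simps parent_union in_union_subset, auto split: option.splits)
  qed
qed

lemma descendant_closed_union:
  "descendant_closed (forest_union f g) (union_subset A B) \<longleftrightarrow>
    descendant_closed f A \<and> descendant_closed g B"
proof -
  let ?S = "union_subset A B"
  have subset: "?S \<subseteq> verts (forest_union f g) \<longleftrightarrow> A \<subseteq> verts f \<and> B \<subseteq> verts g"
    by (simp add: verts_union_subset union_subset_mono)
  have closed: "(\<forall>v w. parent (forest_union f g) w = Some v \<longrightarrow> v \<in> ?S \<longrightarrow> w \<in> ?S) \<longleftrightarrow>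
      (\<forall>v w. parent f w = Some v \<longrightarrow> v \<in> A \<longrightarrow> w \<in> A) \<and> (\<forall>v w. parent g w = Some v \<longrightarrow> v \<in> B \<longrightarrow> w \<in> B)"
    (is "?u \<longleftrightarrow> ?f \<and> ?g")
  proof
    assume u: ?u
    have ?f
    proof (intro allI impI)
      fix v w assume "parent f w = Some v" "v \<in> A"
      then show "w \<in> A" using u[rule_format, of "2 * w" "2 * v"] by (simp only: in_union_subset parent_union option.map)
    qed
    moreover have ?g
    proof (intro allI impI)
      fix v w assume "parent g w = Some v" "v \<in> B"
      then show "w \<in> B" using u[rule_format, of "Suc (2 * w)" "Suc (2 * v)"] by (simp only: in_union_subset parent_union option.map)
    qed
    ultimately show "?f \<and> ?g" ..
  next
    assume fg: "?f \<and> ?g"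
    have "w \<in> ?S" if wv: "parent (forest_union f g) w = Some v" "v \<in> ?S" for v w
    proof (cases "even w")
      case True
      then obtain i where w: "w = 2 * i" by (rule evenE)
      then obtain j where j: "parent f i = Some j" "v = 2 * j"
        using wv(1) by auto
      have "j \<in> A" using wv(2) unfolding j(2) in_union_subset .
      then have "i \<in> A" using fg j(1) by blast
      then show ?thesis unfolding w in_union_subset .
    next
      case False
      then obtain i where w: "w = Suc (2 * i)" by (metis oddE Suc_eq_plus1)
      then obtain j where j: "parent g i = Some j" "v = Suc (2 * j)"
        using wv(1) by auto
      have "j \<in> B" using wv(2) unfolding j(2) in_union_subset .
      then have "i \<in> B" using fg j(1) by blast
      then show ?thesis unfolding w in_union_subset .
    qed
    then show ?u by (intro allI impI)
  qed
  show ?thesis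
    unfolding descendant_closed_def subset closed by (simp only: conj_ac)
qed

text \<open>
  A descendant-closed subset of a disjoint union is a pair of descendant-closed subsets, so the
  coproduct is multiplicative.
\<close>

lemma forest_coproduct_union:
  "forest_coproduct (forest_union f g) =
    (\<Sum>A | descendant_closed f A. \<Sum>B | descendant_closed g B.
      (of_forest (restrict_forest f A) * of_forest (restrict_forest g B)) \<otimes>
      (of_forest (restrict_forest f (verts f - A)) * of_forest (restrict_forest g (verts g - B))))"
proof -
  let ?F = "forest_union f g"
  have "forest_coproduct ?F = (\<Sum>B | descendant_closed g B. \<Sum>A | descendant_closed f A.
      of_forest (restrict_forest ?F (union_subset A B)) \<otimes>
      of_forest (restrict_forest ?F (verts ?F - union_subset A B)))"
    unfolding forest_coproduct_def by (rule sum_union_subsets) (auto simp: descendant_closed_union)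
  also have "\<dots> = (\<Sum>A | descendant_closed f A. \<Sum>B | descendant_closed g B.
      of_forest (restrict_forest ?F (union_subset A B)) \<otimes>
      of_forest (restrict_forest ?F (verts ?F - union_subset A B)))"
    by (rule sum.swap)
  finally show ?thesis
    by (simp add: verts_union_subset union_subset_Diff restrict_union times_of_forest)
qed

definition tensor_mult :: "('u::real_vector ck, 'u ck) tensor \<Rightarrow> ('u ck, 'u ck) tensor \<Rightarrow> ('u ck, 'u ck) tensor"
  where "tensor_mult z w = tensor_lift (\<lambda>x y. tensor_lift (\<lambda>a b. (x * a) \<otimes> (y * b)) w) z"

lemma bilinear_times_tensor:
  fixes x y :: "'u::real_vector ck"
  shows "bilinear (\<lambda>a b. (x * a) \<otimes> (y * b))"
  by (rule bilinearI) (simp_all add: tensor_of_simps distrib_left)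

lemma bilinear_tensor_mult_factor:
  fixes w :: "('u::real_vector ck, 'u ck) tensor"
  shows "bilinear (\<lambda>x y. tensor_lift (\<lambda>a b. (x * a) \<otimes> (y * b)) w)"
  by (rule bilinearI)
     (simp_all add: tensor_of_simps distrib_right tensor_lift_add_map tensor_lift_scale_map)

lemma linear_tensor_mult: "linear (tensor_mult z)" "linear (\<lambda>z. tensor_mult z w)"
proof -
  show "linear (\<lambda>z. tensor_mult z w)"
    unfolding tensor_mult_def by (rule linear_tensor_lift[OF bilinear_tensor_mult_factor])
  show "linear (tensor_mult z)"
    by (rule linearI)
       (simp_all add: tensor_mult_def linear_add[OF linear_tensor_lift[OF bilinear_times_tensor]]
         linear_scale[OF linear_tensor_lift[OF bilinear_times_tensor]]
         tensor_lift_add_map tensor_lift_scale_map)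
qed

lemma tensor_mult_tensor_of: "tensor_mult (x \<otimes> y) w = tensor_lift (\<lambda>a b. (x * a) \<otimes> (y * b)) w"
  unfolding tensor_mult_def by (simp only: tensor_lift_tensor_of[OF bilinear_tensor_mult_factor])

lemma linear_times_ck: "linear (\<lambda>x :: 'u::real_vector ck. x * y)" "linear (\<lambda>y :: 'u::real_vector ck. x * y)"
  by (auto intro!: linearI simp: distrib_left distrib_right)

lemma coproduct_times: "coproduct (x * y) = tensor_mult (coproduct x) (coproduct y)"
proof -
  have "(\<lambda>x. coproduct (x * of_forest g)) = (\<lambda>x. tensor_mult (coproduct x) (forest_coproduct g))" for g :: "'a forest"
  proof (rule ck_linear_eqI')
    show "coproduct (of_forest f * of_forest g) = tensor_mult (coproduct (of_forest f)) (forest_coproduct g)" for f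
      unfolding times_of_forest coproduct_of_forest forest_coproduct_union
      unfolding forest_coproduct_def
      by (simp add: linear_sum[OF linear_tensor_mult(2)] tensor_mult_tensor_of
          tensor_lift_sum[OF bilinear_times_tensor] times_of_forest)
  qed (rule linear_compose[OF linear_times_ck(1) linear_coproduct, unfolded comp_def]
      linear_compose[OF linear_coproduct linear_tensor_mult(2), unfolded comp_def])+
  then have forest: "coproduct (x * of_forest g) = tensor_mult (coproduct x) (coproduct (of_forest g))" for g
    by (simp add: fun_eq_iff coproduct_of_forest)
  have "(\<lambda>y. coproduct (x * y)) = (\<lambda>y. tensor_mult (coproduct x) (coproduct y))"
    by (rule ck_linear_eqI')
       (rule linear_compose[OF linear_times_ck(2) linear_coproduct, unfolded comp_def]
          linear_compose[OF linear_coproduct linear_tensor_mult(1), unfolded comp_def] forest)+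
  then show ?thesis by (simp add: fun_eq_iff)
qed

lemma descendant_closed_empty: "verts f = {} \<Longrightarrow> descendant_closed f A \<longleftrightarrow> A = {}"
  by (auto simp: descendant_closed_def)

lemma coproduct_one: "coproduct 1 = 1 \<otimes> 1"
  unfolding one_ck_def coproduct_of_forest
  by (simp add: forest_coproduct_def descendant_closed_empty of_forest_no_verts restrict_forest_simps flip: one_ck_def)

lemma coproduct_primitive_times:
  assumes "x \<in> primitives"
  shows "coproduct (x * y) =
    tensor_lift (\<lambda>a b. (x * a) \<otimes> b + a \<otimes> (x * b)) (coproduct y)"
proof -
  have "coproduct x = 1 \<otimes> x + x \<otimes> 1" using assms by (simp add: primitives_def)
  then show ?thesis
    by (simp add: coproduct_times linear_add[OF linear_tensor_mult(2)] tensor_mult_tensor_of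
        tensor_lift_add_map add.commute)
qed

section \<open>Cutting a grafting\<close>

text \<open>
  The three restrictions that occur when a descendant-closed set cuts the grafting of \<open>f\<close> onto the
  vertex \<open>v\<close> of \<open>g\<close>.  If the set contains \<open>v\<close>, it contains all of \<open>f\<close> and the grafting survives in the
  upper part; otherwise the upper part is a disjoint union and the grafting survives in the lower part.
\<close>

lemma restrict_graft_above:
  assumes "v \<in> B" "v \<in> verts g"
  shows "restrict_forest (graft f g v) (union_subset (verts f) B) =
    graft f (restrict_forest g B) v"
    (is "restrict_forest _ ?S = _")
proof (rule forest_eqI)
  have v: "v \<in> verts (restrict_forest g B)" using assms by (simp add: restrict_forest_simps)
  show "verts (restrict_forest (graft f g v) ?S) = verts (graft f (restrict_forest g B) v)"
    by (auto simp: restrict_forest_simps graft_simps assms v verts_union)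
  show "decor (restrict_forest (graft f g v) ?S) = decor (graft f (restrict_forest g B) v)"
    by (simp add: restrict_forest_simps graft_simps assms v forest_union_simps cong: if_cong)
  show "parent (restrict_forest (graft f g v) ?S) = parent (graft f (restrict_forest g B) v)"
  proof
    fix u
    show "parent (restrict_forest (graft f g v) ?S) u = parent (graft f (restrict_forest g B) v) u"
    proof (cases u rule: even_odd_cases)
      case (1 i)
      have "i \<in> verts f" if "i \<in> roots f" using that by (simp add: roots_def)
      then show ?thesis
        unfolding 1 parent_graft[OF assms(2)] parent_graft[OF v]
        by (simp only: restrict_forest_simps parent_graft[OF assms(2)] parent_union in_union_subset)
           (auto split: option.splits simp: assms dest: parent_in_verts)
    next
      case (2 i)
      show ?thesis
        unfolding 2 parent_graft[OF assms(2)] parent_graft[OF v]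
        by (simp only: restrict_forest_simps parent_graft[OF assms(2)] parent_union in_union_subset)
           (auto split: option.splits)
    qed
  qed
qed

lemma restrict_graft_upper:
  assumes "v \<notin> B" "v \<in> verts g"
  shows "restrict_forest (graft f g v) (union_subset A B) =
    forest_union (restrict_forest f A) (restrict_forest g B)"
    (is "restrict_forest _ ?S = _")
proof (rule forest_eqI)
  show "verts (restrict_forest (graft f g v) ?S) = verts (forest_union (restrict_forest f A) (restrict_forest g B))"
    by (auto simp: restrict_forest_simps graft_simps assms verts_union)
  show "decor (restrict_forest (graft f g v) ?S) = decor (forest_union (restrict_forest f A) (restrict_forest g B))"
    by (simp add: restrict_forest_simps graft_simps assms forest_union_simps cong: if_cong)
  show "parent (restrict_forest (graft f g v) ?S) = parent (forest_union (restrict_forest f A) (restrict_forest g B))"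
  proof
    fix u
    show "parent (restrict_forest (graft f g v) ?S) u =
        parent (forest_union (restrict_forest f A) (restrict_forest g B)) u"
    proof (cases u rule: even_odd_cases)
      case (1 i)
      have "parent f i = None" if "i \<in> roots f" using that by (auto simp: roots_def)
      then show ?thesis
        unfolding 1
        by (simp only: restrict_forest_simps parent_graft[OF assms(2)] parent_union in_union_subset)
           (auto split: option.splits simp: assms)
    next
      case (2 i)
      show ?thesis
        unfolding 2
        by (simp only: restrict_forest_simps parent_graft[OF assms(2)] parent_union in_union_subset)
           (auto split: option.splits)
    qed
  qed
qed

lemma restrict_graft_lower:
  assumes "v \<in> B" "v \<in> verts g" and A: "descendant_closed f A"
  shows "restrict_forest (graft f g v) (union_subset (verts f - A) B) =
    graft (restrict_forest f (verts f - A)) (restrict_forest g B) v"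
    (is "restrict_forest _ ?S = graft ?f ?g v")
proof (rule forest_eqI)
  have v: "v \<in> verts ?g" using assms by (simp add: restrict_forest_simps)
  show "verts (restrict_forest (graft f g v) ?S) = verts (graft ?f ?g v)"
    by (auto simp: restrict_forest_simps graft_simps assms v verts_union)
  show "decor (restrict_forest (graft f g v) ?S) = decor (graft ?f ?g v)"
    by (simp add: restrict_forest_simps graft_simps assms v forest_union_simps cong: if_cong)
  \<comment> \<open>The lower part contains the parents of its vertices, so its roots are roots of \<open>f\<close>.\<close>
  have parent_lower: "w \<in> verts f - A" if "parent f i = Some w" "i \<notin> A" for i w
    using A that parent_in_verts[OF that(1)] by (auto simp: descendant_closed_def)
  have roots: "i \<in> roots ?f \<longleftrightarrow> i \<in> roots f \<and> i \<notin> A" for i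
    using parent_lower
    by (auto simp: roots_def restrict_forest_simps dom_def split: option.splits if_splits)
  show "parent (restrict_forest (graft f g v) ?S) = parent (graft ?f ?g v)"
  proof
    fix u
    show "parent (restrict_forest (graft f g v) ?S) u = parent (graft ?f ?g v) u"
    proof (cases u rule: even_odd_cases)
      case (1 i)
      have "i \<in> verts f" if "i \<in> roots f" using that by (simp add: roots_def)
      then show ?thesis
        unfolding 1 parent_graft[OF v] roots
        by (simp only: restrict_forest_simps parent_graft[OF assms(2)] parent_union in_union_subset)
           (auto split: option.splits simp: assms dest: parent_in_verts)
    next
      case (2 i)
      show ?thesis
        unfolding 2 parent_graft[OF v]
        by (simp only: restrict_forest_simps parent_graft[OF assms(2)] parent_union in_union_subset)
           (auto split: option.splits)
    qed
  qed
qed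

lemma descendant_closed_roots:
  assumes A: "descendant_closed f A" and roots: "roots f \<subseteq> A"
  shows "A = verts f"
proof
  obtain h :: "nat \<Rightarrow> nat" where h: "\<And>v w. parent f v = Some w \<Longrightarrow> h w < h v"
    by (metis forest_shape_rank forest_shape_forest)
  show "verts f \<subseteq> A"
  proof
    fix v assume "v \<in> verts f"
    then show "v \<in> A"
    proof (induction v rule: measure_induct_rule[of h])
      case (less v)
      show ?case
      proof (cases "parent f v")
        case None
        then show ?thesis using less.prems roots by (auto simp: roots_def)
      next
        case (Some w)
        then have "w \<in> A" using less.IH h parent_in_verts by blast
        then show ?thesis using A Some by (auto simp: descendant_closed_def)
      qed
    qed
  qed
  show "A \<subseteq> verts f" using A by (simp add: descendant_closed_def)
qed

lemma descendant_closed_graft_iff_union: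
  assumes v: "v \<in> verts g"
  shows "descendant_closed (graft f g v) S \<longleftrightarrow>
    descendant_closed (forest_union f g) S \<and> (Suc (2 * v) \<in> S \<longrightarrow> (\<lambda>i. 2 * i) ` roots f \<subseteq> S)"
proof -
  define R where "R = (\<lambda>i. 2 * i) ` roots f"
  have parent: "parent (graft f g v) u = (if u \<in> R then Some (Suc (2 * v)) else parent (forest_union f g) u)" for u
    by (simp add: graft_simps v R_def)
  have not_root: "u \<notin> R" if "parent (forest_union f g) u = Some w" for u w
    using that by (auto simp: roots_def R_def)
  then show ?thesis
    unfolding descendant_closed_def graft_simps(1)[OF v] parent R_def[symmetric]
    by (auto split: if_splits dest: not_root)
qed

lemma descendant_closed_graft:
  assumes v: "v \<in> verts g"
  shows "descendant_closed (graft f g v) (union_subset A B) \<longleftrightarrow>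
    descendant_closed f A \<and> descendant_closed g B \<and> (v \<in> B \<longrightarrow> A = verts f)"
    (is "descendant_closed _ ?S \<longleftrightarrow> _")
proof -
  have "Suc (2 * v) \<in> ?S \<longleftrightarrow> v \<in> B" "(\<lambda>i. 2 * i) ` roots f \<subseteq> ?S \<longleftrightarrow> roots f \<subseteq> A"
    by auto
  moreover have "descendant_closed f A \<Longrightarrow> roots f \<subseteq> A \<longleftrightarrow> A = verts f"
    using descendant_closed_roots[of f A] by (auto simp: roots_def)
  ultimately show ?thesis
    unfolding descendant_closed_graft_iff_union[OF v] descendant_closed_union by (simp only: conj_ac cong: conj_cong)
qed

section \<open>The grading by the number of vertices\<close>

text \<open>
  Natural growth divides by the number of vertices, which spoils the multiplicativity of the vertex sums
  under cutting.  Operators diagonal in the grading remove the division: with \<open>c n = n\<close> the operator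
  \<open>nverts_scale c\<close> is the derivation that counts vertices, and with \<open>c n = 1 / n\<close> it inverts this
  derivation off the constants.
\<close>

definition nverts_scale :: "(nat \<Rightarrow> real) \<Rightarrow> 'u::real_vector ck \<Rightarrow> 'u ck"
  where "nverts_scale c = ck_lift (\<lambda>f. c (nverts f) *\<^sub>R of_forest f)"

lemma nverts_iso: "forest_iso f g \<Longrightarrow> nverts f = nverts g"
  unfolding forest_iso_iff by (blast dest: iso_viaD(1) bij_betw_same_card)

lemma compatible_nverts_scale:
  assumes "compatible \<phi>"
  shows "compatible (\<lambda>f. c (nverts f) *\<^sub>R \<phi> f)"
  by (rule compatibleI)
     (simp_all add: compatible_redecorate[OF assms] scaleR_add_right mult.commute
       nverts_iso[of f g for f g] compatible_iso[OF assms, of f g for f g])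

lemma linear_nverts_scale: "linear (nverts_scale c)"
  unfolding nverts_scale_def by (intro linear_ck_lift compatible_nverts_scale compatible_of_forest)

lemma nverts_scale_of_forest: "nverts_scale c (of_forest f) = c (nverts f) *\<^sub>R of_forest f"
  unfolding nverts_scale_def
  by (rule ck_lift_of_forest) (intro compatible_nverts_scale compatible_of_forest)

lemma nverts_scale_one: "nverts_scale c 1 = c 0 *\<^sub>R 1"
  unfolding one_ck_def nverts_scale_of_forest by simp

lemma nverts_scale_compose: "nverts_scale c (nverts_scale d z) = nverts_scale (\<lambda>n. c n * d n) z"
  by (rule ck_linear_eqI[OF linear_compose[OF linear_nverts_scale linear_nverts_scale, unfolded comp_def]
        linear_nverts_scale])
     (simp add: nverts_scale_of_forest linear_scale[OF linear_nverts_scale])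

definition tensor_nverts_scale :: "(nat \<Rightarrow> real) \<Rightarrow> 'u::real_vector ck \<Rightarrow> 'u ck \<Rightarrow> ('u ck, 'u ck) tensor"
  where "tensor_nverts_scale c = ck_lift2 (\<lambda>f g. c (nverts f + nverts g) *\<^sub>R (of_forest f \<otimes> of_forest g))"

lemma compatible_compose_linear:
  assumes "linear L" "compatible \<phi>"
  shows "compatible (\<lambda>f. L (\<phi> f))"
  by (rule compatibleI)
     (auto simp: compatible_redecorate[OF assms(2)] linear_add[OF assms(1)] linear_scale[OF assms(1)]
       dest: compatible_iso[OF assms(2)])

lemma linear_tensor_of: "linear (\<lambda>x. x \<otimes> y)" "linear (\<lambda>y. x \<otimes> y)"
  by (auto intro!: linearI simp: tensor_of_simps)

lemma compatible_tensor_nverts_scale: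
  "compatible (\<lambda>g. c (nverts f + nverts g) *\<^sub>R (of_forest f \<otimes> of_forest g))"
  "compatible (\<lambda>f. c (nverts f + nverts g) *\<^sub>R (of_forest f \<otimes> of_forest g))"
  using compatible_nverts_scale[OF compatible_compose_linear[OF linear_tensor_of(2) compatible_of_forest],
      of "\<lambda>n. c (nverts f + n)"]
    compatible_nverts_scale[OF compatible_compose_linear[OF linear_tensor_of(1) compatible_of_forest],
      of "\<lambda>n. c (n + nverts g)"] by blast+

lemma bilinear_tensor_nverts_scale: "bilinear (tensor_nverts_scale c)"
  unfolding tensor_nverts_scale_def
  by (rule bilinear_ck_lift2) (rule compatible_tensor_nverts_scale)+

lemma tensor_nverts_scale_of_forest:
  "tensor_nverts_scale c (of_forest f) (of_forest g) = c (nverts f + nverts g) *\<^sub>R (of_forest f \<otimes> of_forest g)"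
  unfolding tensor_nverts_scale_def
  by (rule ck_lift2_of_forest) (rule compatible_tensor_nverts_scale)+

lemma nverts_restrict:
  "A \<subseteq> verts f \<Longrightarrow> nverts (restrict_forest f A) + nverts (restrict_forest f (verts f - A)) = nverts f"
  by (simp add: restrict_forest_simps Int_absorb1 Int_Diff card_Diff_subset finite_subset[of A "verts f"] card_mono)

text \<open>
  The coproduct preserves the grading, since a cut distributes the vertices over its two parts.
\<close>

lemma coproduct_nverts_scale:
  "coproduct (nverts_scale c z) = tensor_lift (tensor_nverts_scale c) (coproduct z)"
proof (rule ck_linear_eqI[OF linear_compose[OF linear_nverts_scale linear_coproduct, unfolded comp_def]
      linear_compose[OF linear_coproduct linear_tensor_lift[OF bilinear_tensor_nverts_scale], unfolded comp_def]])
  fix f :: "'a forest"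
  have "tensor_lift (tensor_nverts_scale c) (forest_coproduct f) = (\<Sum>A | descendant_closed f A.
      c (nverts f) *\<^sub>R (of_forest (restrict_forest f A) \<otimes> of_forest (restrict_forest f (verts f - A))))"
    unfolding forest_coproduct_def tensor_lift_sum[OF bilinear_tensor_nverts_scale]
    by (intro sum.cong) (auto simp: tensor_nverts_scale_of_forest nverts_restrict descendant_closed_def)
  then show "coproduct (nverts_scale c (of_forest f)) = tensor_lift (tensor_nverts_scale c) (coproduct (of_forest f))"
    by (simp add: nverts_scale_of_forest linear_scale[OF linear_coproduct] coproduct_of_forest
        forest_coproduct_def scaleR_sum_right)
qed

lemma tensor_nverts_scale_one:
  "tensor_nverts_scale c 1 z = 1 \<otimes> nverts_scale c z" "tensor_nverts_scale c z 1 = nverts_scale c z \<otimes> 1"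
proof -
  have lin: "linear (tensor_nverts_scale c 1)" "linear (\<lambda>z. tensor_nverts_scale c z 1)"
    "linear (\<lambda>z. 1 \<otimes> nverts_scale c z)" "linear (\<lambda>z. nverts_scale c z \<otimes> 1)"
    by (auto simp: bilinear_ladd[OF bilinear_tensor_nverts_scale] bilinear_radd[OF bilinear_tensor_nverts_scale]
        bilinear_lmul[OF bilinear_tensor_nverts_scale] bilinear_rmul[OF bilinear_tensor_nverts_scale]
        tensor_of_simps linear_add[OF linear_nverts_scale] linear_scale[OF linear_nverts_scale] intro!: linearI)
  show "tensor_nverts_scale c 1 z = 1 \<otimes> nverts_scale c z"
    by (rule ck_linear_eqI[OF lin(1,3)])
       (simp add: one_ck_def tensor_nverts_scale_of_forest nverts_scale_of_forest tensor_of_simps)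
  show "tensor_nverts_scale c z 1 = nverts_scale c z \<otimes> 1"
    by (rule ck_linear_eqI[OF lin(2,4)])
       (simp add: one_ck_def tensor_nverts_scale_of_forest nverts_scale_of_forest tensor_of_simps)
qed

lemma nverts_scale_primitive: "p \<in> primitives \<Longrightarrow> nverts_scale c p \<in> primitives"
  by (simp add: primitives_def coproduct_nverts_scale linear_add[OF linear_tensor_lift[OF bilinear_tensor_nverts_scale]]
      tensor_lift_tensor_of[OF bilinear_tensor_nverts_scale] tensor_nverts_scale_one)

text \<open>
  Here \<open>nverts_scale\<close> is the projection onto the component of degree \<open>0\<close>.
\<close>

lemma counit_scale_is_scalar: "nverts_scale (\<lambda>n. if n = 0 then 1 else 0) z \<in> span {1}"
proof -
  let ?c = "\<lambda>n. if n = 0 then 1 else 0 :: real"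
  have "z \<in> span (range of_forest)" by (simp add: span_of_forest)
  then show ?thesis
  proof (induction rule: span_induct_alt)
    case base
    show ?case by (simp add: linear_0[OF linear_nverts_scale] span_zero)
  next
    case (step a x y)
    obtain f where f: "x = of_forest f" using step(1) by blast
    have "nverts_scale ?c x \<in> span {1}"
      by (cases "verts f = {}") (simp_all add: f nverts_scale_of_forest of_forest_no_verts nverts_scale_one span_base span_zero)
    then show ?case using step(2)
      by (simp add: linear_add[OF linear_nverts_scale] linear_scale[OF linear_nverts_scale] span_add span_scale)
  qed
qed

text \<open>
  A scalar \<open>c\<close> is primitive only if \<open>c (1 \<otimes> 1) = 2 c (1 \<otimes> 1)\<close>, and \<open>1 \<otimes> 1\<close> is non-zero because the
  counit \<open>\<epsilon>\<close> satisfies \<open>(\<epsilon> \<otimes> \<epsilon>) (1 \<otimes> 1) = 1\<close>.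
\<close>

lemma primitive_scalar_eq_0:
  assumes "z \<in> primitives" "z \<in> span {1}"
  shows "z = 0"
proof -
  obtain c where c: "z = c *\<^sub>R 1" using assms(2) by (auto simp: span_singleton)
  let ?\<epsilon> = "ck_lift (\<lambda>f :: 'a forest. if verts f = {} then 1 else 0 :: real)"
  have \<epsilon>: "compatible (\<lambda>f :: 'a forest. if verts f = {} then 1 else 0 :: real)"
    by (rule compatibleI) (auto simp: forest_iso_iff dest: iso_viaD(3))
  have lin: "linear ?\<epsilon>" by (rule linear_ck_lift[OF \<epsilon>])
  have one: "?\<epsilon> 1 = 1" unfolding one_ck_def ck_lift_of_forest[OF \<epsilon>] by simp
  have bil: "bilinear (\<lambda>x y. ?\<epsilon> x * ?\<epsilon> y)"
    by (rule bilinearI) (simp_all add: linear_add[OF lin] linear_scale[OF lin] algebra_simps)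
  have "c *\<^sub>R (1 \<otimes> 1 :: ('a ck, 'a ck) tensor) = c *\<^sub>R (1 \<otimes> 1) + c *\<^sub>R (1 \<otimes> 1)"
    using assms(1) unfolding primitives_def c
    by (simp add: linear_scale[OF linear_coproduct] coproduct_one tensor_of_simps)
  then have "c *\<^sub>R (1 \<otimes> 1 :: ('a ck, 'a ck) tensor) = 0" by simp
  then have "tensor_lift (\<lambda>x y. ?\<epsilon> x * ?\<epsilon> y) (c *\<^sub>R (1 \<otimes> 1)) = 0"
    by (simp only: linear_0[OF linear_tensor_lift[OF bil]])
  then have "c = 0"
    by (simp add: linear_scale[OF linear_tensor_lift[OF bil]] tensor_lift_tensor_of[OF bil] one)
  then show ?thesis by (simp add: c)
qed

text \<open>
  Primitive elements are the vertex-count derivatives of primitive elements: division by the degree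
  preserves primitivity, and there is no component of degree \<open>0\<close> that would obstruct it.
\<close>

lemma primitive_eq_nverts_scale:
  assumes "p \<in> primitives"
  obtains q where "q \<in> primitives" "p = nverts_scale real q"
proof
  let ?E = "nverts_scale (\<lambda>n. 1 / real n)"
  show "?E p \<in> primitives" by (rule nverts_scale_primitive[OF assms])
  let ?e = "nverts_scale (\<lambda>n. if n = 0 then 1 else 0)"
  \<comment> \<open>\<open>n * (1 / n)\<close> is \<open>1\<close> for \<open>n > 0\<close> and \<open>0\<close> for \<open>n = 0\<close>.\<close>
  have "p = nverts_scale real (?E p) + ?e p"
    unfolding nverts_scale_compose
    by (rule ck_linear_eqI[of "\<lambda>p. p" "\<lambda>p. nverts_scale _ p + nverts_scale _ p",
          OF linear_ident linear_compose_add[OF linear_nverts_scale linear_nverts_scale]])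
       (simp add: nverts_scale_of_forest)
  moreover have "?e p = 0"
    by (rule primitive_scalar_eq_0[OF nverts_scale_primitive[OF assms] counit_scale_is_scalar])
  ultimately show "p = nverts_scale real (?E p)" by simp
qed

section \<open>The coproduct of natural growth\<close>

text \<open>
  Grafting the empty forest onto a vertex of \<open>g\<close> gives \<open>g\<close> itself, so that the formula covers the
  conventions of natural growth for the empty forest as well.
\<close>

lemma growth_nverts_scale:
  "of_forest f \<top> nverts_scale real (of_forest g) = (\<Sum>v\<in>verts g. of_forest (graft f g v))"
proof (cases "verts f = {}")
  case True
  have "of_forest (graft f g v) = of_forest g" if v: "v \<in> verts g" for v
  proof (rule of_forest_iso[of "\<lambda>u. u div 2"], rule iso_viaI)
    have no_roots: "roots f = {}" using True by (simp add: roots_def)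
    have verts: "verts (graft f g v) = (\<lambda>i. Suc (2 * i)) ` verts g"
      by (simp add: graft_simps v verts_union True)
    show "inj_on (\<lambda>u. u div 2) (verts (graft f g v))"
      unfolding verts by (auto simp: inj_on_def)
    show "(\<lambda>u. u div 2) ` verts (graft f g v) = verts g"
      unfolding verts by (simp add: image_image)
    fix u assume "u \<in> verts (graft f g v)"
    then obtain i where u: "u = Suc (2 * i)" unfolding verts by blast
    show "parent g (u div 2) = map_option (\<lambda>u. u div 2) (parent (graft f g v) u)"
      unfolding u parent_graft[OF v] by (simp add: option.map_comp comp_def option.map_ident)
    show "decor g (u div 2) = decor (graft f g v) u"
      unfolding u by (simp add: graft_simps v)
  qed
  moreover have "of_forest f = 1" by (rule of_forest_no_verts[OF True])
  ultimately show ?thesis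
    by (simp add: nverts_scale_of_forest sum_constant_scaleR del: sum_constant)
next
  case False
  then show ?thesis
    by (simp add: nverts_scale_of_forest growth_simps growth_of_forest forest_growth_def)
qed

text \<open>
  The cuts of a grafting are enumerated by their trace \<open>B\<close> on \<open>g\<close> first, because \<open>B\<close> decides whether the
  trace on \<open>f\<close> is all of \<open>f\<close> or an arbitrary descendant-closed set.
\<close>

lemma forest_coproduct_graft:
  assumes v: "v \<in> verts g"
  shows "forest_coproduct (graft f g v) =
    (\<Sum>B | descendant_closed g B. if v \<in> B
      then of_forest (graft f (restrict_forest g B) v) \<otimes> of_forest (restrict_forest g (verts g - B))
      else (\<Sum>A | descendant_closed f A.
        (of_forest (restrict_forest f A) * of_forest (restrict_forest g B)) \<otimes>
        of_forest (graft (restrict_forest f (verts f - A)) (restrict_forest g (verts g - B)) v)))"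
proof -
  let ?t = "\<lambda>S. of_forest (restrict_forest (graft f g v) S) \<otimes>
    of_forest (restrict_forest (graft f g v) (verts (graft f g v) - S))"
  \<comment> \<open>The cuts of \<open>f\<close> compatible with a cut \<open>B\<close> of \<open>g\<close>.\<close>
  let ?I = "\<lambda>B. if v \<in> B then {verts f} else {A. descendant_closed f A}"
  have "descendant_closed f (verts f)"
    by (auto simp: descendant_closed_def dest: parent_in_verts)
  then have "A \<in> ?I B \<longleftrightarrow> descendant_closed f A \<and> (v \<in> B \<longrightarrow> A = verts f)" for A B
    by auto
  then have "forest_coproduct (graft f g v) =
      (\<Sum>B | descendant_closed g B. \<Sum>A\<in>?I B. ?t (union_subset A B))"
    unfolding forest_coproduct_def
    by (intro sum_union_subsets) (simp_all add: descendant_closed_graft[OF v] conj_ac)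
  also have "\<dots> = (\<Sum>B | descendant_closed g B. if v \<in> B
      then of_forest (graft f (restrict_forest g B) v) \<otimes> of_forest (restrict_forest g (verts g - B))
      else (\<Sum>A | descendant_closed f A.
        (of_forest (restrict_forest f A) * of_forest (restrict_forest g B)) \<otimes>
        of_forest (graft (restrict_forest f (verts f - A)) (restrict_forest g (verts g - B)) v)))"
  proof (rule sum.cong[OF refl])
    fix B assume B: "B \<in> {B. descendant_closed g B}"
    show "(\<Sum>A\<in>?I B. ?t (union_subset A B)) = (if v \<in> B
      then of_forest (graft f (restrict_forest g B) v) \<otimes> of_forest (restrict_forest g (verts g - B))
      else (\<Sum>A | descendant_closed f A.
        (of_forest (restrict_forest f A) * of_forest (restrict_forest g B)) \<otimes>
        of_forest (graft (restrict_forest f (verts f - A)) (restrict_forest g (verts g - B)) v)))"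
    proof (cases "v \<in> B")
      case True
      have "of_forest (forest_union (restrict_forest f {}) (restrict_forest g (verts g - B))) =
          of_forest (restrict_forest g (verts g - B))"
        unfolding times_of_forest[symmetric] by (simp add: of_forest_no_verts restrict_forest_simps)
      then show ?thesis
        using True restrict_graft_upper[of v "verts g - B" g f "{}"] v
        by (simp add: graft_simps(1) verts_union_subset union_subset_Diff restrict_graft_above)
    next
      case False
      then have "?t (union_subset A B) = (of_forest (restrict_forest f A) * of_forest (restrict_forest g B)) \<otimes>
        of_forest (graft (restrict_forest f (verts f - A)) (restrict_forest g (verts g - B)) v)"
        if "descendant_closed f A" for A
        using that v by (simp add: graft_simps(1) verts_union_subset union_subset_Diff restrict_graft_upper restrict_graft_lower times_of_forest)
      then show ?thesis using False by simp
    qed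
  qed
  finally show ?thesis .
qed

text \<open>
  The contribution of a cut of \<open>g\<close> into \<open>x\<close> (upper part) and \<open>y\<close> (lower part) to the coproduct of the
  sum of all graftings of \<open>z\<close> onto \<open>g\<close>: the grafting vertex lies in \<open>x\<close>, or it lies in \<open>y\<close> and \<open>z\<close> is
  cut too.
\<close>

definition growth_coproduct :: "'u::real_vector ck \<Rightarrow> 'u ck \<Rightarrow> 'u ck \<Rightarrow> ('u ck, 'u ck) tensor"
  where "growth_coproduct z x y = (z \<top> nverts_scale real x) \<otimes> y +
    tensor_lift (\<lambda>a b. (a * x) \<otimes> (b \<top> nverts_scale real y)) (coproduct z)"

lemma bilinear_growth_coproduct_terms:
  fixes x y :: "'u::real_vector ck"
  shows "bilinear (\<lambda>a b. (a * x) \<otimes> (b \<top> nverts_scale real y))"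
  by (rule bilinearI) (simp_all add: tensor_of_simps growth_simps distrib_right)

lemma bilinear_growth_coproduct: "bilinear (growth_coproduct z)"
  unfolding growth_coproduct_def
  by (rule bilinearI)
     (simp_all add: tensor_of_simps growth_simps distrib_left tensor_lift_add_map tensor_lift_scale_map
       linear_add[OF linear_nverts_scale] linear_scale[OF linear_nverts_scale] scaleR_add_right)

text \<open>
  After exchanging the sums over the grafting vertex \<open>v\<close> and over the cut \<open>B\<close> of \<open>g\<close>, the vertices in \<open>B\<close>
  and those outside \<open>B\<close> add up to full sums of graftings onto the two parts of the cut.
\<close>

lemma coproduct_growth_forest:
  "coproduct (of_forest f \<top> nverts_scale real q) = tensor_lift (growth_coproduct (of_forest f)) (coproduct q)"
proof (rule ck_linear_eqI[where z = q])
  show "linear (\<lambda>q. coproduct (of_forest f \<top> nverts_scale real q))"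
    by (rule linearI) (simp_all add: growth_simps linear_add[OF linear_nverts_scale]
        linear_scale[OF linear_nverts_scale] linear_add[OF linear_coproduct] linear_scale[OF linear_coproduct])
  show "linear (\<lambda>q. tensor_lift (growth_coproduct (of_forest f)) (coproduct q))"
    by (rule linear_compose[OF linear_coproduct linear_tensor_lift[OF bilinear_growth_coproduct], unfolded comp_def])
  fix g :: "'a forest"
  let ?G = "restrict_forest g" and ?F = "restrict_forest f"
  let ?u = "\<lambda>B v. of_forest (graft f (?G B) v) \<otimes> of_forest (?G (verts g - B))"
  let ?l = "\<lambda>A B v. (of_forest (?F A) * of_forest (?G B)) \<otimes> of_forest (graft (?F (verts f - A)) (?G (verts g - B)) v)"
  have "coproduct (of_forest f \<top> nverts_scale real (of_forest g)) = (\<Sum>v\<in>verts g. \<Sum>B | descendant_closed g B.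
      if v \<in> B then ?u B v else (\<Sum>A | descendant_closed f A. ?l A B v))"
    by (simp add: growth_nverts_scale linear_sum[OF linear_coproduct] coproduct_of_forest forest_coproduct_graft)
  also have "\<dots> = (\<Sum>B | descendant_closed g B. \<Sum>v\<in>verts g.
      if v \<in> B then ?u B v else (\<Sum>A | descendant_closed f A. ?l A B v))"
    by (rule sum.swap)
  also have "\<dots> = (\<Sum>B | descendant_closed g B. growth_coproduct (of_forest f) (of_forest (?G B)) (of_forest (?G (verts g - B))))"
  proof (rule sum.cong[OF refl])
    fix B assume "B \<in> {B. descendant_closed g B}"
    then have B: "B \<subseteq> verts g" by (simp add: descendant_closed_def)
    then have verts: "verts (?G B) = B" "verts (?G (verts g - B)) = verts g - B"
      by (auto simp: restrict_forest_simps)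
    have "(\<Sum>v\<in>verts g. if v \<in> B then ?u B v else (\<Sum>A | descendant_closed f A. ?l A B v)) =
        (\<Sum>v\<in>B. ?u B v) + (\<Sum>v\<in>verts g - B. \<Sum>A | descendant_closed f A. ?l A B v)"
      by (simp add: sum.If_cases Int_absorb1[OF B] Diff_eq Collect_neg_eq)
    also have "\<dots> = (\<Sum>v\<in>B. ?u B v) + (\<Sum>A | descendant_closed f A. \<Sum>v\<in>verts g - B. ?l A B v)"
      by (subst (2) sum.swap) (rule refl)
    also have "\<dots> = growth_coproduct (of_forest f) (of_forest (?G B)) (of_forest (?G (verts g - B)))"
      unfolding growth_coproduct_def coproduct_of_forest forest_coproduct_def
        tensor_lift_sum[OF bilinear_growth_coproduct_terms] growth_nverts_scale verts
        tensor_of_sum_left tensor_of_sum_right ..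
    finally show "(\<Sum>v\<in>verts g. if v \<in> B then ?u B v else (\<Sum>A | descendant_closed f A. ?l A B v)) =
        growth_coproduct (of_forest f) (of_forest (?G B)) (of_forest (?G (verts g - B)))" .
  qed
  also have "\<dots> = tensor_lift (growth_coproduct (of_forest f)) (coproduct (of_forest g))"
    unfolding coproduct_of_forest forest_coproduct_def tensor_lift_sum[OF bilinear_growth_coproduct] ..
  finally show "coproduct (of_forest f \<top> nverts_scale real (of_forest g)) =
      tensor_lift (growth_coproduct (of_forest f)) (coproduct (of_forest g))" .
qed

lemma bilinear_growth_right_factor: "bilinear (\<lambda>a b. a \<otimes> (b \<top> p))"
  by (rule bilinearI) (simp_all add: tensor_of_simps growth_simps)

text \<open>
  For primitive \<open>q\<close> with vertex-count derivative \<open>p\<close> only the cuts \<open>1 \<otimes> q\<close> and \<open>q \<otimes> 1\<close> matter, and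
  grafting onto \<open>1\<close> contributes no vertex.  Thus \<open>z \<mapsto> z \<top> p\<close> is a cocycle.
\<close>

lemma coproduct_growth_primitive:
  assumes "p \<in> primitives"
  shows "coproduct (z \<top> p) = (z \<top> p) \<otimes> 1 + tensor_lift (\<lambda>a b. a \<otimes> (b \<top> p)) (coproduct z)"
proof -
  obtain q where q: "q \<in> primitives" and p: "p = nverts_scale real q"
    using primitive_eq_nverts_scale[OF assms] .
  have one: "nverts_scale real 1 = 0" by (simp add: nverts_scale_one)
  show ?thesis
  proof (rule ck_linear_eqI[where z = z])
    show "linear (\<lambda>z. coproduct (z \<top> p))"
      by (rule linearI) (simp_all add: growth_simps linear_add[OF linear_coproduct] linear_scale[OF linear_coproduct])
    show "linear (\<lambda>z. (z \<top> p) \<otimes> 1 + tensor_lift (\<lambda>a b. a \<otimes> (b \<top> p)) (coproduct z))"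
      by (rule linearI)
         (simp_all add: growth_simps tensor_of_simps linear_add[OF linear_coproduct] linear_scale[OF linear_coproduct]
           linear_add[OF linear_tensor_lift[OF bilinear_growth_right_factor]]
           linear_scale[OF linear_tensor_lift[OF bilinear_growth_right_factor]] scaleR_add_right)
    fix f :: "'a forest"
    have "coproduct (of_forest f \<top> p) = tensor_lift (growth_coproduct (of_forest f)) (1 \<otimes> q + q \<otimes> 1)"
      using q unfolding p coproduct_growth_forest by (simp add: primitives_def)
    also have "\<dots> = growth_coproduct (of_forest f) 1 q + growth_coproduct (of_forest f) q 1"
      by (simp add: linear_add[OF linear_tensor_lift[OF bilinear_growth_coproduct]]
          tensor_lift_tensor_of[OF bilinear_growth_coproduct])
    also have "\<dots> = (of_forest f \<top> p) \<otimes> 1 + tensor_lift (\<lambda>a b. a \<otimes> (b \<top> p)) (coproduct (of_forest f))"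
      using tensor_lift_scale_map[of 0 "\<lambda>_ _. 0" "coproduct (of_forest f)"]
      by (simp add: growth_coproduct_def one growth_simps tensor_of_simps p)
    finally show "coproduct (of_forest f \<top> p) =
        (of_forest f \<top> p) \<otimes> 1 + tensor_lift (\<lambda>a b. a \<otimes> (b \<top> p)) (coproduct (of_forest f))" .
  qed
qed

text \<open>
  The sequence of powers is group-like: each application of the cocycle \<open>z \<mapsto> z \<top> p\<close> raises the right
  factors and adds the term with right factor \<open>1\<close>.
\<close>

lemma coproduct_growth_power:
  assumes "p \<in> primitives"
  shows "coproduct (growth_power p n) = (\<Sum>i\<le>n. growth_power p i \<otimes> growth_power p (n - i))"
proof (induction n)
  case 0
  show ?case by (simp add: coproduct_one)
next
  case (Suc n)
  have "coproduct (growth_power p (Suc n)) = growth_power p (Suc n) \<otimes> 1 +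
      (\<Sum>i\<le>n. growth_power p i \<otimes> (growth_power p (n - i) \<top> p))"
    by (simp add: coproduct_growth_primitive[OF assms] Suc tensor_lift_sum[OF bilinear_growth_right_factor])
  also have "\<dots> = growth_power p (Suc n) \<otimes> 1 + (\<Sum>i\<le>n. growth_power p i \<otimes> growth_power p (Suc n - i))"
    by (intro arg_cong2[of _ _ _ _ plus] sum.cong refl) (simp add: Suc_diff_le)
  also have "\<dots> = (\<Sum>i\<le>Suc n. growth_power p i \<otimes> growth_power p (Suc n - i))"
    by (simp add: add.commute)
  finally show ?case .
qed

section \<open>The logarithm of a group-like sequence is primitive\<close>

lemma bilinear_primitive_action:
  fixes x :: "'u::real_vector ck"
  shows "bilinear (\<lambda>a b. (x * a) \<otimes> b + a \<otimes> (x * b))"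
  by (rule bilinearI) (simp_all add: tensor_of_simps distrib_left scaleR_add_right)

text \<open>
  The two re-indexings of sums over \<open>k + i + j = n\<close> that collect the factor with index \<open>k\<close> of a
  convolution, taken in the left or in the right tensor factor.
\<close>

lemma sum_swap_triangle:
  fixes u :: "nat \<Rightarrow> nat \<Rightarrow> 'a::comm_monoid_add"
  shows "(\<Sum>j\<le>n. \<Sum>k=1..j. u j k) = (\<Sum>k=1..n. \<Sum>i\<le>n-k. u (k + i) k)"
    and "(\<Sum>j\<le>n. \<Sum>k=1..n-j. u j k) = (\<Sum>k=1..n. \<Sum>j\<le>n-k. u j k)"
proof -
  have "(\<Sum>(j, k)\<in>(SIGMA j:{..n}. {1..j}). u j k) = (\<Sum>(k, i)\<in>(SIGMA k:{1..n}. {..n-k}). u (k + i) k)"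
    by (rule sum.reindex_bij_witness[where i = "\<lambda>(k, i). (k + i, k)" and j = "\<lambda>(j, k). (k, j - k)"]) auto
  then show "(\<Sum>j\<le>n. \<Sum>k=1..j. u j k) = (\<Sum>k=1..n. \<Sum>i\<le>n-k. u (k + i) k)"
    by (simp add: sum.Sigma)
  have "(\<Sum>(j, k)\<in>(SIGMA j:{..n}. {1..n-j}). u j k) = (\<Sum>(k, j)\<in>(SIGMA k:{1..n}. {..n-k}). u j k)"
    by (rule sum.reindex_bij_witness[where i = "\<lambda>(k, j). (j, k)" and j = "\<lambda>(j, k). (k, j)"]) auto
  then show "(\<Sum>j\<le>n. \<Sum>k=1..n-j. u j k) = (\<Sum>k=1..n. \<Sum>j\<le>n-k. u j k)"
    by (simp add: sum.Sigma)
qed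

text \<open>
  Let \<open>G\<close> be the generating series of \<open>g\<close> and \<open>L = log G\<close>.  Applying \<open>D = t d/dt\<close> to \<open>G \<otimes> G\<close> and using
  \<open>D G = D L * G\<close> in either factor shows that \<open>D G\<close> has coproduct
  \<open>(D L \<otimes> 1 + 1 \<otimes> D L) * (G \<otimes> G)\<close>.  It is also the coproduct of \<open>D L * G\<close>; comparing coefficients of
  \<open>t\<^sup>n\<close>, the terms with smaller index agree by induction, and what remains is the primitivity of the
  coefficient of index \<open>n\<close> of \<open>L\<close>.
\<close>

lemma log_sum_primitive:
  fixes g :: "nat \<Rightarrow> 'u::real_vector ck"
  assumes g0: "g 0 = 1"
    and grouplike: "\<And>n. coproduct (g n) = (\<Sum>i\<le>n. g i \<otimes> g (n - i))"
    and "n \<ge> 1"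
  shows "log_sum g n \<in> primitives"
  using \<open>n \<ge> 1\<close>
proof (induction n rule: less_induct)
  case (less n)
  let ?L = "log_sum g"
  let ?act = "\<lambda>k a b. (?L k * a) \<otimes> b + a \<otimes> (?L k * b)"
  have "real n *\<^sub>R coproduct (g n) = (\<Sum>j\<le>n. (real j *\<^sub>R g j) \<otimes> g (n - j)) + (\<Sum>j\<le>n. g j \<otimes> (real (n - j) *\<^sub>R g (n - j)))"
    unfolding grouplike scaleR_sum_right sum.distrib[symmetric]
    by (intro sum.cong refl) (simp add: tensor_of_simps of_nat_diff flip: scaleR_add_left)
  also have "(\<Sum>j\<le>n. (real j *\<^sub>R g j) \<otimes> g (n - j)) =
      (\<Sum>j\<le>n. \<Sum>k=1..j. real k *\<^sub>R ((?L k * g (j - k)) \<otimes> g (n - j)))"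
    by (simp only: log_sum_recursion[of g, OF g0] tensor_of_sum_left tensor_of_simps)
  also have "\<dots> = (\<Sum>k=1..n. \<Sum>i\<le>n-k. real k *\<^sub>R ((?L k * g i) \<otimes> g (n - k - i)))"
    unfolding sum_swap_triangle(1) by simp
  also have "(\<Sum>j\<le>n. g j \<otimes> (real (n - j) *\<^sub>R g (n - j))) =
      (\<Sum>j\<le>n. \<Sum>k=1..n-j. real k *\<^sub>R (g j \<otimes> (?L k * g (n - j - k))))"
    by (simp only: log_sum_recursion[of g, OF g0] tensor_of_sum_right tensor_of_simps)
  also have "\<dots> = (\<Sum>k=1..n. \<Sum>i\<le>n-k. real k *\<^sub>R (g i \<otimes> (?L k * g (n - k - i))))"
    unfolding sum_swap_triangle(2) by (simp add: add.commute)
  \<comment> \<open>\<open>D (G \<otimes> G) = (D L \<otimes> 1 + 1 \<otimes> D L) * (G \<otimes> G)\<close> in degree \<open>n\<close>.\<close>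
  finally have derivation: "real n *\<^sub>R coproduct (g n) =
      (\<Sum>k=1..n. real k *\<^sub>R tensor_lift (?act k) (coproduct (g (n - k))))"
    unfolding grouplike tensor_lift_sum[OF bilinear_primitive_action]
    by (simp only: sum.distrib[symmetric] scaleR_add_right scaleR_sum_right)
  have split: "{1..n} = insert n {1..<n}" using less.prems by auto
  have "real n *\<^sub>R coproduct (g n) = (\<Sum>k=1..n. real k *\<^sub>R coproduct (?L k * g (n - k)))"
    by (simp only: log_sum_recursion[of g, OF g0] linear_sum[OF linear_coproduct] linear_scale[OF linear_coproduct]
        flip: linear_scale[OF linear_coproduct, of "real n"])
  then have "(\<Sum>k=1..n. real k *\<^sub>R coproduct (?L k * g (n - k))) =
      (\<Sum>k=1..n. real k *\<^sub>R tensor_lift (?act k) (coproduct (g (n - k))))"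
    unfolding derivation by simp
  moreover have "(\<Sum>k\<in>{1..<n}. real k *\<^sub>R coproduct (?L k * g (n - k))) =
      (\<Sum>k\<in>{1..<n}. real k *\<^sub>R tensor_lift (?act k) (coproduct (g (n - k))))"
    using less.IH by (intro sum.cong refl) (simp add: coproduct_primitive_times)
  ultimately have "real n *\<^sub>R coproduct (?L n) = real n *\<^sub>R tensor_lift (?act n) (1 \<otimes> 1)"
    unfolding split by (simp add: g0 coproduct_one)
  then have "coproduct (?L n) = ?L n \<otimes> 1 + 1 \<otimes> ?L n"
    using less.prems by (simp add: tensor_lift_tensor_of[OF bilinear_primitive_action])
  then show ?case
    by (simp add: primitives_def add.commute)
qed

section \<open>The logarithm of natural growth and its evaluation on signatures\<close>

lemma growth_log_eq: "growth_log p n = log_sum (growth_power p) n"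
  by (simp add: growth_log_def weight_sum_def)

lemma growth_log_primitive: "p \<in> primitives \<Longrightarrow> n \<ge> 1 \<Longrightarrow> growth_log p n \<in> primitives"
  unfolding growth_log_eq by (rule log_sum_primitive) (simp_all add: coproduct_growth_power)

lemma growth_power_eq_exp:
  "growth_power p n = (\<Sum>a\<in>weight_tuples n. \<Prod>k=1..n. (1 / fact (a k) :: real) *\<^sub>R growth_log p k ^ a k)"
  unfolding growth_log_eq exp_sum_eq[symmetric] by (rule exp_sum_log_sum[symmetric]) simp

lemma multiplicative_on_forests:
  fixes X :: "'u::real_vector ck \<Rightarrow> real"
  assumes "linear X" "\<And>f g. X (of_forest f * of_forest g) = X (of_forest f) * X (of_forest g)"
  shows "X (x * y) = X x * X y"
proof -
  have lin: "linear (\<lambda>x. X (x * y))" "linear (\<lambda>x. X (y * x))" "linear (\<lambda>x. X x * X y)" "linear (\<lambda>x. X y * X x)" for y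
    by (auto intro!: linearI simp: linear_add[OF assms(1)] linear_scale[OF assms(1)] algebra_simps)
  have "X (x * of_forest g) = X x * X (of_forest g)" for g
    by (rule ck_linear_eqI[OF lin(1,3) assms(2)])
  then show ?thesis by (rule ck_linear_eqI[OF lin(2,4)])
qed

lemma character_growth_power:
  fixes X :: "'u::real_vector ck \<Rightarrow> real"
  assumes lin: "linear X" and one: "X 1 = 1" and mult: "\<And>x y. X (x * y) = X x * X y"
  shows "X (growth_power p n) = (\<Sum>a\<in>weight_tuples n. \<Prod>k=1..n. X (growth_log p k) ^ a k / fact (a k))"
proof -
  have pow: "X (x ^ m) = X x ^ m" for x m by (induction m) (simp_all add: one mult)
  have prod: "X (prod h K) = (\<Prod>k\<in>K. X (h k))" for h and K :: "nat set"
    by (induction K rule: infinite_finite_induct) (simp_all add: one mult)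
  show ?thesis
    by (subst growth_power_eq_exp) (simp add: linear_sum[OF lin] prod linear_scale[OF lin] pow)
qed

lemma tensor_eval_primitive:
  assumes "linear X" "linear Y" "X 1 = 1" "Y 1 = 1" "x \<in> primitives"
  shows "tensor_eval X Y (coproduct x) = X x + Y x"
proof -
  have bil: "bilinear (\<lambda>x y. X x * Y y)"
    by (rule bilinearI)
       (simp_all add: linear_add[OF assms(1)] linear_scale[OF assms(1)] linear_add[OF assms(2)] linear_scale[OF assms(2)] algebra_simps)
  show ?thesis
    using assms(3-5) by (simp add: tensor_eval_def primitives_def linear_add[OF linear_tensor_lift[OF bil]] tensor_lift_tensor_of[OF bil])
qed

lemma ck_upto_infinity: "ck_upto \<infinity> = UNIV"
  by (simp add: ck_upto_def span_of_forest full_SetCompr_eq)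

theorem proposition4p1:
  fixes p :: "'u::real_vector ck"
  assumes "\<exists>B :: 'u set. finite B \<and> span B = UNIV"
    and "p \<in> primitives"
  shows "(\<forall>n\<ge>1.
        growth_power p n =
          (\<Sum>a\<in>weight_tuples n. \<Prod>k=1..n. (1 / fact (a k) :: real) *\<^sub>R growth_log p k ^ a k) \<and>
        growth_log p n \<in> primitives) \<and>
    ((\<exists>B :: 'v::real_normed_vector set. finite B \<and> span B = UNIV) \<longrightarrow>
      (\<forall>(q :: ('v \<Rightarrow>\<^sub>L real) ck) \<rho> \<omega> T X S.
        q \<in> primitives \<and> branched_rough_path \<rho> \<omega> T X \<and> is_signature \<rho> \<omega> T X S \<longrightarrow>
        (\<forall>n\<ge>1. \<forall>s t. 0 \<le> s \<and> s \<le> t \<and> t \<le> T \<longrightarrow>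
          S s t (growth_power q n) =
            (\<Sum>a\<in>weight_tuples n. \<Prod>k=1..n. S s t (growth_log q k) ^ a k / fact (a k))) \<and>
        (\<forall>k\<ge>1. \<forall>s u t. 0 \<le> s \<and> s \<le> u \<and> u \<le> t \<and> t \<le> T \<longrightarrow>
          S s t (growth_log q k) = S s u (growth_log q k) + S u t (growth_log q k))))"
proof (rule conjI)
  show "\<forall>n\<ge>1.
        growth_power p n =
          (\<Sum>a\<in>weight_tuples n. \<Prod>k=1..n. (1 / fact (a k) :: real) *\<^sub>R growth_log p k ^ a k) \<and>
        growth_log p n \<in> primitives"
    using growth_power_eq_exp growth_log_primitive[OF assms(2)] by blast
next
  have "S s t (growth_power q n) =
        (\<Sum>a\<in>weight_tuples n. \<Prod>k=1..n. S s t (growth_log q k) ^ a k / fact (a k))"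
    if "is_signature \<rho> \<omega> T X S" "0 \<le> s \<and> s \<le> t \<and> t \<le> T"
    for q :: "('v \<Rightarrow>\<^sub>L real) ck" and \<rho> \<omega> T X S n s t
  proof -
    have S: "linear (S s t)" "S s t 1 = 1"
      "S s t (of_forest f * of_forest g) = S s t (of_forest f) * S s t (of_forest g)" for f g
      using that by (auto simp: is_signature_def branched_upto_def)
    show ?thesis
      by (rule character_growth_power[OF S(1,2) multiplicative_on_forests[OF S(1,3)]])
  qed
  moreover have "S s t (growth_log q k) = S s u (growth_log q k) + S u t (growth_log q k)"
    if "q \<in> primitives" "is_signature \<rho> \<omega> T X S" "k \<ge> 1" "0 \<le> s \<and> s \<le> u \<and> u \<le> t \<and> t \<le> T"
    for q :: "('v \<Rightarrow>\<^sub>L real) ck" and \<rho> \<omega> T X S k s u t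
  proof -
    have su: "0 \<le> s \<and> s \<le> u \<and> u \<le> T" and ut: "0 \<le> u \<and> u \<le> t \<and> t \<le> T" using that(4) by auto
    have S: "linear (S s u)" "linear (S u t)" "S s u 1 = 1" "S u t 1 = 1"
      using that(2) su ut by (auto simp: is_signature_def branched_upto_def)
    have "S s t (growth_log q k) = tensor_eval (S s u) (S u t) (coproduct (growth_log q k))"
      using that(2,4) unfolding is_signature_def branched_upto_def ck_upto_infinity by blast
    then show ?thesis
      using tensor_eval_primitive[OF S growth_log_primitive[OF that(1,3)]] by simp
  qed
  ultimately show "(\<exists>B :: 'v set. finite B \<and> span B = UNIV) \<longrightarrow>
      (\<forall>(q :: ('v \<Rightarrow>\<^sub>L real) ck) \<rho> \<omega> T X S.
        q \<in> primitives \<and> branched_rough_path \<rho> \<omega> T X \<and> is_signature \<rho> \<omega> T X S \<longrightarrow>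
        (\<forall>n\<ge>1. \<forall>s t. 0 \<le> s \<and> s \<le> t \<and> t \<le> T \<longrightarrow>
          S s t (growth_power q n) =
            (\<Sum>a\<in>weight_tuples n. \<Prod>k=1..n. S s t (growth_log q k) ^ a k / fact (a k))) \<and>
        (\<forall>k\<ge>1. \<forall>s u t. 0 \<le> s \<and> s \<le> u \<and> u \<le> t \<and> t \<le> T \<longrightarrow>
          S s t (growth_log q k) = S s u (growth_log q k) + S u t (growth_log q k)))"
    by blast
qed

end
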